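(* Helly's theorem does not generalize to cell-convex drawings, i.e., there are a cell-convex topological drawing of a complete graph in the plane and a finite family of triangles of the drawing such that the bounded sides of any three triangles of the family have a common point, but the intersection of the bounded sides of all triangles of the family is empty. Moreover, for every integer $n\ge 3$ there exists a cell-convex topological drawing of $K_{3n}$ in the plane with Helly number at least $n$, i.e., there are $n$ triangles of the drawing such that the bounded sides of any $n-1$ of these triangles have a common interior point, but the intersection of the bounded sides of all $n$ triangles is empty.
   Context: A (simple) topological drawing of the complete graph $K_m$ in the plane maps vertices to distinct points and edges to simple curves connecting the two corresponding vertices and containing no other vertices, such that every pair of edges has at most one common point, which is either a common vertex or a crossing (not a touching). It is also assumed that no three edges cross in a single point. A cell of a drawing is a connected component of the complement of the drawing in the plane. A triangle of a topological drawing is the subdrawing induced by three vertices; its three edges do not cross, so they form a simple closed curve whose removal separates the plane into a bounded and an unbounded component. The closures of these components are the sides of the triangle (the bounded side and the unbounded side). A side of a triangle is convex if every edge of the drawing that has both end-vertices in the side is completely drawn in the side. A topological drawing is cell-convex if there is a special cell $c_\infty$ (not necessarily the unbounded cell) such that, for every triangle, the side not containing $c_\infty$ is convex. The Helly number of a family of sets with empty intersection is the size of the smallest subfamily with empty intersection. Helly's theorem in the plane asserts that, for a finite family of convex sets in $\mathbb{R}^2$, the whole intersection is non-empty whenever the intersection of every subfamily of size $3$ is non-empty. *)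

theory Defs
  imports "HOL-Analysis.Analysis" "HOL-Library.Ramsey"
begin

text \<open>
  The vertices of \<open>K\<^sub>m\<close> are \<open>{..<m}\<close>, its edges the 2-subsets \<open>nsets {..<m} 2\<close>, and the
  triangles of a drawing are given by their vertex sets \<open>nsets {..<m} 3\<close>.
\<close>

record drawing =
  vert :: "nat \<Rightarrow> complex"
  edge :: "nat set \<Rightarrow> complex set"

text \<open>
  A crossing (as opposed to a touching): near \<open>p\<close>, the pair of curves looks like the two
  coordinate axes at the origin, up to a homeomorphism. In particular \<open>p\<close> is not an
  end-point of either curve.
\<close>

definition crosses_at :: "complex set \<Rightarrow> complex set \<Rightarrow> complex \<Rightarrow> bool" where
  "crosses_at A B p \<longleftrightarrow>
     (\<exists>U h k. open U \<and> p \<in> U \<and> homeomorphism U (ball 0 1) h k \<and> h p = 0 \<and>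
        h ` (A \<inter> U) = {z \<in> ball 0 1. Im z = 0} \<and>
        h ` (B \<inter> U) = {z \<in> ball 0 1. Re z = 0})"

definition topological_drawing :: "nat \<Rightarrow> drawing \<Rightarrow> bool" where
  "topological_drawing m D \<longleftrightarrow>
     inj_on (vert D) {..<m} \<and>
     (\<forall>e \<in> nsets {..<m} 2.
        (\<exists>g. arc g \<and> path_image g = edge D e \<and> {pathstart g, pathfinish g} = vert D ` e) \<and>
        edge D e \<inter> vert D ` {..<m} = vert D ` e) \<and>
     (\<forall>e \<in> nsets {..<m} 2. \<forall>f \<in> nsets {..<m} 2. e \<noteq> f \<longrightarrow>
        (\<forall>p \<in> edge D e \<inter> edge D f. \<forall>q \<in> edge D e \<inter> edge D f. p = q) \<and>
        (\<forall>p \<in> edge D e \<inter> edge D f.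
           p \<in> vert D ` (e \<inter> f) \<or> crosses_at (edge D e) (edge D f) p)) \<and>
     (\<forall>e \<in> nsets {..<m} 2. \<forall>f \<in> nsets {..<m} 2. \<forall>g \<in> nsets {..<m} 2.
        e \<noteq> f \<and> e \<noteq> g \<and> f \<noteq> g \<longrightarrow>
        \<not> (\<exists>p. crosses_at (edge D e) (edge D f) p \<and> crosses_at (edge D e) (edge D g) p \<and>
               crosses_at (edge D f) (edge D g) p))"

definition cells :: "nat \<Rightarrow> drawing \<Rightarrow> complex set set" where
  "cells m D = components (- (vert D ` {..<m} \<union> (\<Union>e \<in> nsets {..<m} 2. edge D e)))"

definition triangle_curve :: "drawing \<Rightarrow> nat set \<Rightarrow> complex set" where
  "triangle_curve D T = (\<Union>e \<in> nsets T 2. edge D e)"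

definition bounded_side :: "drawing \<Rightarrow> nat set \<Rightarrow> complex set" where
  "bounded_side D T = closure (inside (triangle_curve D T))"

definition unbounded_side :: "drawing \<Rightarrow> nat set \<Rightarrow> complex set" where
  "unbounded_side D T = closure (outside (triangle_curve D T))"

definition convex_side :: "nat \<Rightarrow> drawing \<Rightarrow> complex set \<Rightarrow> bool" where
  "convex_side m D S \<longleftrightarrow> (\<forall>e \<in> nsets {..<m} 2. vert D ` e \<subseteq> S \<longrightarrow> edge D e \<subseteq> S)"

definition cell_convex :: "nat \<Rightarrow> drawing \<Rightarrow> bool" where
  "cell_convex m D \<longleftrightarrow>
     (\<exists>c \<in> cells m D. \<forall>T \<in> nsets {..<m} 3. \<forall>S \<in> {bounded_side D T, unbounded_side D T}.
        \<not> c \<subseteq> S \<longrightarrow> convex_side m D S)"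

text \<open>Only meaningful for finite families with empty intersection.\<close>

definition helly_number :: "'a set set \<Rightarrow> nat" where
  "helly_number F = (LEAST k. \<exists>G. G \<subseteq> F \<and> finite G \<and> card G = k \<and> \<Inter>G = {})"

end

theory Submission
  imports Defs
begin

text \<open>
  Take a straight-line drawing in which a triangle \<open>T\<^sub>0\<close> not containing \<open>0\<close> is covered by the
  interiors of triangles \<open>T\<^sub>1, \<dots>, T\<^sub>n\<^sub>-\<^sub>1\<close>, all of which contain \<open>0\<close> in the interior, such that
  no \<open>n - 2\<close> of them cover \<open>T\<^sub>0\<close>. The inversion \<open>z \<mapsto> 1/z\<close> moves the point \<open>0\<close> to infinity. The
  drawing remains cell-convex, with the image of the former unbounded cell as \<open>c\<^sub>\<infinity>\<close>, and the bounded side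
  of \<open>T\<^sub>i\<close> is the image of the complement of its interior for \<open>i \<ge> 1\<close>, and of \<open>T\<^sub>0\<close> itself for \<open>i = 0\<close>. So
  all \<open>n\<close> bounded sides together have no common point, but any \<open>n - 1\<close> of them do.

  For \<open>T\<^sub>0\<close> we take a thin triangle along a segment, for the others wedges with apex just beyond \<open>0\<close>
  which cut the segment into \<open>n - 1\<close> pieces. General position is reached by a small perturbation.
\<close>

subsection \<open>Crossings of inverted segments\<close>

text \<open>The determinant of \<open>u\<close> and \<open>v\<close> as plane vectors, zero exactly
  when they are linearly dependent over the reals.\<close>

definition cross :: "complex \<Rightarrow> complex \<Rightarrow> real" where
  "cross u v = Re u * Im v - Im u * Re v"

text \<open>Collinearity says that \<open>(c - a) / (b - a)\<close> is real, and its imaginary part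
  is the determinant divided by a squared norm. If \<open>a = b\<close>, division by zero yields 0
  and both sides hold.\<close>

lemma collinear_iff_cross: "collinear {a, b, c} \<longleftrightarrow> cross (b - a) (c - a) = 0"
proof -
  have "collinear {a, b, c} \<longleftrightarrow> collinear {0, b - a, c - a}"
    using collinear_3[of b a c] by (cases "b = 0") (auto simp: insert_commute collinear_3)
  also have "\<dots> \<longleftrightarrow> (c - a) / (b - a) \<in> \<real>"
    by (rule collinear_iff_Reals)
  also have "\<dots> \<longleftrightarrow> cross (b - a) (c - a) = 0"
    by (auto simp: complex_is_Real_iff Im_divide cross_def complex_eq_iff algebra_simps
        sum_power2_eq_zero_iff)
  finally show ?thesis .
qed

lemma cross_independent:
  assumes "cross u v \<noteq> 0" and "x *\<^sub>R u + y *\<^sub>R v = 0"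
  shows "x = 0" and "y = 0"
proof -
  have "cross (x *\<^sub>R u + y *\<^sub>R v) v = x * cross u v" "cross u (x *\<^sub>R u + y *\<^sub>R v) = y * cross u v"
    by (simp_all add: cross_def algebra_simps)
  then show "x = 0" "y = 0"
    using assms by (simp_all add: cross_def)
qed

lemma continuous_on_cinverse: "0 \<notin> S \<Longrightarrow> continuous_on S (inverse :: complex \<Rightarrow> complex)"
  by (intro continuous_intros) auto

lemma inj_cinverse: "inj_on (inverse :: complex \<Rightarrow> complex) S"
  by (simp add: inj_on_def)

lemma open_inverse_image:
  fixes S :: "complex set"
  assumes "open S" "0 \<notin> S"
  shows "open (inverse ` S)"
  using assms by (intro invariance_of_domain continuous_on_cinverse inj_cinverse)

lemma mem_inverse_image: "z \<in> inverse ` S \<longleftrightarrow> inverse z \<in> S" for z :: complex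
  by (metis imageE imageI inverse_inverse_eq)

lemma closed_segment_param:
  fixes a b :: complex
  shows "a + t *\<^sub>R (b - a) \<in> closed_segment a b \<longleftrightarrow> a = b \<or> 0 \<le> t \<and> t \<le> 1"
proof
  assume "a + t *\<^sub>R (b - a) \<in> closed_segment a b"
  then obtain s where s: "0 \<le> s" "s \<le> 1" "a + t *\<^sub>R (b - a) = (1 - s) *\<^sub>R a + s *\<^sub>R b"
    by (auto simp: in_segment)
  then have "(t - s) *\<^sub>R (b - a) = 0"
    by (simp add: algebra_simps)
  with s show "a = b \<or> 0 \<le> t \<and> t \<le> 1"
    by auto
next
  assume "a = b \<or> 0 \<le> t \<and> t \<le> 1"
  then show "a + t *\<^sub>R (b - a) \<in> closed_segment a b"
  proof
    assume "0 \<le> t \<and> t \<le> 1"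
    moreover have "a + t *\<^sub>R (b - a) = (1 - t) *\<^sub>R a + t *\<^sub>R b"
      by (simp add: algebra_simps)
    ultimately show ?thesis
      unfolding in_segment by blast
  qed simp
qed

text \<open>In oblique coordinates centred at \<open>q\<close>, the bounds on \<open>r\<close> keep
  the parameter \<open>s + r * Re z\<close> within [0, 1], so locally the segment is the whole axis
  \<open>Im z = 0\<close>.\<close>

lemma chart_segment:
  fixes a b v q :: complex
  assumes q: "q = a + s *\<^sub>R (b - a)" and D: "cross (b - a) v \<noteq> 0"
    and r: "0 < r" "r \<le> s" "r \<le> 1 - s" and z: "cmod z < 1"
  shows "q + r *\<^sub>R (Re z *\<^sub>R (b - a) + Im z *\<^sub>R v) \<in> closed_segment a b \<longleftrightarrow> Im z = 0"
proof
  assume "q + r *\<^sub>R (Re z *\<^sub>R (b - a) + Im z *\<^sub>R v) \<in> closed_segment a b"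
  then obtain t where "q + r *\<^sub>R (Re z *\<^sub>R (b - a) + Im z *\<^sub>R v) = (1 - t) *\<^sub>R a + t *\<^sub>R b"
    by (auto simp: in_segment)
  then have "(s + r * Re z - t) *\<^sub>R (b - a) + (r * Im z) *\<^sub>R v = 0"
    unfolding q by (simp add: algebra_simps)
  then show "Im z = 0"
    using cross_independent(2)[OF D] r(1) by (metis less_irrefl mult_eq_0_iff)
next
  assume "Im z = 0"
  have "\<bar>r * Re z\<bar> \<le> r"
    using abs_Re_le_cmod[of z] z r(1) by (simp add: abs_mult)
  then have "0 \<le> s + r * Re z" "s + r * Re z \<le> 1"
    using r by linarith+
  then have "a + (s + r * Re z) *\<^sub>R (b - a) \<in> closed_segment a b"
    by (simp add: closed_segment_param)
  moreover have "q + r *\<^sub>R (Re z *\<^sub>R (b - a) + Im z *\<^sub>R v) = a + (s + r * Re z) *\<^sub>R (b - a)"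
    unfolding q using \<open>Im z = 0\<close> by (simp only: scaleR_add_left scaleR_add_right scaleR_scaleR) simp
  ultimately show "q + r *\<^sub>R (Re z *\<^sub>R (b - a) + Im z *\<^sub>R v) \<in> closed_segment a b"
    by simp
qed

text \<open>The chart required by \<open>crosses_at\<close> is inversion followed by affine
  coordinates centred at \<open>q\<close> whose axes run along the two segments.\<close>

lemma crosses_at_inverse_segments:
  fixes a b c d q :: complex
  assumes q: "q = a + s *\<^sub>R (b - a)" "q = c + t *\<^sub>R (d - c)"
    and st: "0 < s" "s < 1" "0 < t" "t < 1"
    and D: "cross (b - a) (d - c) \<noteq> 0" and "q \<noteq> 0"
  shows "crosses_at (inverse ` closed_segment a b) (inverse ` closed_segment c d) (inverse q)"
proof -
  define u v where "u = b - a" and "v = d - c"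
  have D': "cross u v \<noteq> 0" "cross v u \<noteq> 0"
    using D by (auto simp: u_def v_def cross_def algebra_simps)
  define N where "N = cmod u + cmod v"
  have "u \<noteq> 0"
    using D' by (auto simp: cross_def)
  then have N: "N > 0"
    by (simp add: N_def add_pos_nonneg)
  \<comment> \<open>The bounds by \<open>s\<close>, \<open>1 - s\<close>, \<open>t\<close> and
    \<open>1 - t\<close> keep the axes of the chart within the segments; the last one gives
    \<open>r * N < cmod q\<close>, so the chart avoids 0.\<close>
  define r where "r = min (min (min s (1 - s)) (min t (1 - t))) (cmod q / (2 * N))"
  have r: "0 < r" "r \<le> s" "r \<le> 1 - s" "r \<le> t" "r \<le> 1 - t" "r \<le> cmod q / (2 * N)"
    using st \<open>q \<noteq> 0\<close> N by (auto simp: r_def)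
  have rN: "r * N < cmod q"
  proof -
    have "r * N \<le> cmod q / (2 * N) * N"
      using r(6) N by (intro mult_right_mono) auto
    also have "\<dots> = cmod q / 2"
      using N by simp
    also have "\<dots> < cmod q"
      using \<open>q \<noteq> 0\<close> by simp
    finally show ?thesis .
  qed
  define k where "k z = q + r *\<^sub>R (Re z *\<^sub>R u + Im z *\<^sub>R v)" for z
  \<comment> \<open>The inverse of the affine map \<open>k\<close>, by Cramer's rule.\<close>
  define h where "h w = Complex (cross (w - q) v / (r * cross u v)) (cross u (w - q) / (r * cross u v))" for w
  have hk: "h (k z) = z" for z
  proof -
    have "cross (k z - q) v = Re z * (r * cross u v)" "cross u (k z - q) = Im z * (r * cross u v)"
      by (simp_all add: k_def cross_def algebra_simps)
    then show ?thesis
      using D' r(1) by (simp add: h_def complex_eq_iff)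
  qed
  have kh: "k (h w) = w" for w
  proof -
    have "Re w - Re q = (cross (w - q) v * Re u + cross u (w - q) * Re v) / cross u v"
      "Im w - Im q = (cross (w - q) v * Im u + cross u (w - q) * Im v) / cross u v"
      using D' by (simp_all add: field_simps) (simp_all add: cross_def algebra_simps)
    then show ?thesis
      using r(1) by (simp add: k_def h_def complex_eq_iff field_simps add_divide_distrib)
  qed
  have conth: "continuous_on S h" for S
    unfolding h_def cross_def Complex_eq by (intro continuous_intros) (use D' r in \<open>auto simp: cross_def\<close>)
  have contk: "continuous_on S k" for S
    unfolding k_def by (intro continuous_intros)
  define V where "V = k ` ball 0 1"
  have V_iff: "w \<in> V \<longleftrightarrow> h w \<in> ball 0 1" for w
    unfolding V_def by (metis hk kh imageE imageI)
  have "V = h -` ball 0 1"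
    by (intro set_eqI) (simp only: V_iff vimage_eq)
  then have "open V"
    using conth[of UNIV] by (simp add: open_vimage)
  have "0 \<notin> V"
  proof
    assume "0 \<in> V"
    then obtain z where z: "cmod z < 1" "k z = 0"
      by (auto simp: V_def)
    have "cmod (Re z *\<^sub>R u + Im z *\<^sub>R v) \<le> \<bar>Re z\<bar> * cmod u + \<bar>Im z\<bar> * cmod v"
      by (metis norm_scaleR norm_triangle_ineq)
    also have "\<dots> \<le> 1 * cmod u + 1 * cmod v"
      using abs_Re_le_cmod[of z] abs_Im_le_cmod[of z] z(1) by (intro add_mono mult_right_mono) auto
    finally have "r * cmod (Re z *\<^sub>R u + Im z *\<^sub>R v) \<le> r * N"
      using r(1) by (simp add: N_def)
    moreover have "q = - (r *\<^sub>R (Re z *\<^sub>R u + Im z *\<^sub>R v))"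
      using z(2) by (simp add: k_def eq_neg_iff_add_eq_0)
    then have "cmod q = r * cmod (Re z *\<^sub>R u + Im z *\<^sub>R v)"
      using r(1) by (metis abs_of_pos norm_minus_cancel norm_scaleR)
    ultimately show False
      using rN by simp
  qed
  define U where "U = inverse ` V"
  have U_iff: "w \<in> U \<longleftrightarrow> inverse w \<in> V" for w
    by (simp add: U_def mem_inverse_image)
  have "0 \<notin> U"
    using \<open>0 \<notin> V\<close> by (simp add: U_iff)
  have homeo: "homeomorphism U (ball 0 1) (h \<circ> inverse) (inverse \<circ> k)"
  proof (rule homeomorphismI)
    show "continuous_on U (h \<circ> inverse)"
      using \<open>0 \<notin> U\<close> conth by (intro continuous_on_compose continuous_on_cinverse)
    show "continuous_on (ball 0 1) (inverse \<circ> k)"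
      using \<open>0 \<notin> V\<close> by (intro continuous_on_compose contk continuous_on_cinverse) (simp add: V_def)
  qed (auto simp: U_def V_def hk kh)
  have A: "k z \<in> closed_segment a b \<longleftrightarrow> Im z = 0" if "cmod z < 1" for z
    using chart_segment[OF q(1) D r(1-3) that] by (simp add: k_def u_def v_def)
  \<comment> \<open>The second segment is the other axis, so the coordinates are swapped before
    applying \<open>chart_segment\<close>.\<close>
  have B: "k z \<in> closed_segment c d \<longleftrightarrow> Re z = 0" if "cmod z < 1" for z
    using chart_segment[OF q(2) D'(2)[unfolded v_def] r(1,4,5), of "Complex (Im z) (Re z)"] that
    by (simp add: k_def v_def cmod_def add.commute)
  have img: "(h \<circ> inverse) ` (inverse ` S \<inter> U) = {z \<in> ball 0 1. k z \<in> S}" for S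
  proof (intro equalityI subsetI)
    fix z assume "z \<in> (h \<circ> inverse) ` (inverse ` S \<inter> U)"
    then obtain w where "w \<in> S" "w \<in> V" "z = h w"
      by (auto simp: mem_inverse_image U_def)
    then show "z \<in> {z \<in> ball 0 1. k z \<in> S}"
      using V_iff kh by simp
  next
    fix z assume z: "z \<in> {z \<in> ball 0 1. k z \<in> S}"
    then have "inverse (k z) \<in> inverse ` S \<inter> U"
      by (auto simp: U_def V_def)
    moreover have "z = (h \<circ> inverse) (inverse (k z))"
      by (simp add: hk)
    ultimately show "z \<in> (h \<circ> inverse) ` (inverse ` S \<inter> U)"
      by blast
  qed
  show ?thesis
    unfolding crosses_at_def
  proof (intro exI conjI)
    show "open U"
      unfolding U_def using \<open>open V\<close> \<open>0 \<notin> V\<close> by (rule open_inverse_image)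
    have "h q = 0"
      using hk[of 0] by (simp add: k_def)
    then show "inverse q \<in> U" "(h \<circ> inverse) (inverse q) = 0"
      by (simp_all add: U_iff V_iff)
    show "homeomorphism U (ball 0 1) (h \<circ> inverse) (inverse \<circ> k)"
      by (rule homeo)
    show "(h \<circ> inverse) ` (inverse ` closed_segment a b \<inter> U) = {z \<in> ball 0 1. Im z = 0}"
      unfolding img using A by auto
    show "(h \<circ> inverse) ` (inverse ` closed_segment c d \<inter> U) = {z \<in> ball 0 1. Re z = 0}"
      unfolding img using B by auto
  qed
qed

text \<open>At a crossing the arc would continue on both sides of the point. The parameter along the
  segment would then be continuous and injective on an interval, hence strictly monotone, and yet
  minimal at an inner point.\<close>

lemma not_crosses_at_endpoint:
  assumes "0 \<notin> closed_segment a b" "a \<noteq> b"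
  shows "\<not> crosses_at (inverse ` closed_segment a b) B (inverse a)"
proof
  let ?A = "inverse ` closed_segment a b"
  assume "crosses_at ?A B (inverse a)"
  then obtain U h k where U: "inverse a \<in> U" and hom: "homeomorphism U (ball 0 1) h k"
    and h0: "h (inverse a) = 0" and hA: "h ` (?A \<inter> U) = {z \<in> ball 0 1. Im z = 0}"
    unfolding crosses_at_def by blast
  \<comment> \<open>Undoes the inversion and reads off the affine parameter: 0 at
    \<open>inverse a\<close>, 1 at \<open>inverse b\<close>.\<close>
  define \<tau> where "\<tau> w = Re ((inverse w - a) / (b - a))" for w
  have tau: "\<tau> (inverse (a + t *\<^sub>R (b - a))) = t" for t
    using assms(2) by (simp add: \<tau>_def scaleR_conv_of_real)
  have A_eq: "?A = (\<lambda>t. inverse (a + t *\<^sub>R (b - a))) ` {0..1}"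
    by (simp add: closed_segment_image_interval image_image algebra_simps)
  have tau_ge: "\<tau> w \<ge> 0" if "w \<in> ?A" for w
    using that unfolding A_eq by (auto simp: tau)
  have tau_inj: "inj_on \<tau> ?A"
    unfolding A_eq by (auto simp: inj_on_def tau)
  have "0 \<notin> ?A"
    using assms(1) by auto
  have ka: "k 0 = inverse a"
    using hom U h0 by (metis homeomorphism_apply1)
  have kA: "k z \<in> ?A" if z: "z \<in> ball 0 1" "Im z = 0" for z
  proof -
    obtain w where "w \<in> ?A" "w \<in> U" "z = h w"
      using z hA by (smt (verit, best) IntD1 IntD2 imageE mem_Collect_eq)
    then show ?thesis
      using hom by (simp add: homeomorphism_apply1)
  qed
  define \<psi> where "\<psi> x = \<tau> (k (of_real x))" for x :: real
  let ?I = "{-1/2..1/2::real}"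
  have I: "complex_of_real x \<in> ball 0 1" if "x \<in> ?I" for x
    using that by auto
  have contk: "continuous_on ?I (\<lambda>x. k (of_real x))"
    by (rule continuous_on_compose2[OF homeomorphism_cont2[OF hom]])
       (use I in \<open>auto intro!: continuous_intros\<close>)
  have kI: "k (of_real x) \<in> ?A" if "x \<in> ?I" for x
    using I that by (intro kA) auto
  have "k (of_real x) \<noteq> 0" if "x \<in> ?I" for x
    using kI[OF that] \<open>0 \<notin> ?A\<close> by metis
  then have "continuous_on ?I (\<lambda>x. inverse (k (of_real x)))"
    using contk by (intro continuous_on_inverse) auto
  then have "continuous_on ?I \<psi>"
    unfolding \<psi>_def \<tau>_def using assms(2)
    by (intro continuous_on_Re continuous_on_divide continuous_on_diff continuous_on_const) auto
  moreover have "inj_on \<psi> ?I"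
  proof (rule inj_onI)
    fix x y assume xy: "x \<in> ?I" "y \<in> ?I" "\<psi> x = \<psi> y"
    then have "k (of_real x) = k (of_real y)"
      using tau_inj kI unfolding \<psi>_def inj_on_def by blast
    then have "h (k (of_real x)) = h (k (of_real y))"
      by simp
    then show "x = y"
      using homeomorphism_apply2[OF hom] I xy by auto
  qed
  ultimately have "\<psi> (-1/2) < \<psi> 0 \<and> \<psi> 0 < \<psi> (1/2) \<or> \<psi> (1/2) < \<psi> 0 \<and> \<psi> 0 < \<psi> (-1/2)"
    by (intro continuous_inj_imp_mono) auto
  moreover have "\<psi> 0 = 0"
    using tau[of 0] by (simp add: \<psi>_def ka)
  moreover have "\<psi> (-1/2) \<ge> 0" "\<psi> (1/2) \<ge> 0"
    unfolding \<psi>_def by (intro tau_ge kI; simp)+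
  ultimately show False
    by linarith
qed

subsection \<open>Inverted convex bodies\<close>

text \<open>A component of \<open>- S\<close> meeting \<open>A\<close> cannot leave it, so it is
  bounded; \<open>B\<close> lies within a single component, which is unbounded.\<close>

lemma inside_outside_eq:
  fixes S :: "'a::real_normed_vector set"
  assumes "open A" "open B" "A \<inter> B = {}" "- S = A \<union> B" "bounded A" "connected B" "\<not> bounded B"
  shows "inside S = A" "outside S = B"
proof -
  have "A \<subseteq> inside S"
  proof
    fix x assume "x \<in> A"
    let ?C = "connected_component_set (- S) x"
    have "x \<in> ?C"
      using \<open>x \<in> A\<close> assms(4) by auto
    moreover have "?C \<subseteq> A \<union> B"
      using connected_component_subset[of "- S" x] assms(4) by simp
    ultimately have "?C \<subseteq> A"
      using connectedD[OF connected_connected_component assms(1,2), of "- S" x] assms(3) \<open>x \<in> A\<close> by blast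
    then show "x \<in> inside S"
      using assms(4,5) \<open>x \<in> A\<close> by (auto simp: inside_def intro: bounded_subset)
  qed
  moreover have "B \<subseteq> outside S"
  proof
    fix x assume "x \<in> B"
    then have "B \<subseteq> connected_component_set (- S) x"
      using assms(4,6) by (intro connected_component_maximal) auto
    then show "x \<in> outside S"
      using assms(7) by (auto simp: outside intro: bounded_subset)
  qed
  moreover have "inside S \<union> outside S = A \<union> B" "inside S \<inter> outside S = {}"
    using assms(4) by (auto simp del: inside_Un_outside simp: inside_Un_outside[of S])
  ultimately show "inside S = A" "outside S = B"
    by blast+
qed

lemma unbounded_inverse_image:
  fixes X :: "complex set"
  assumes "0 < e" "ball 0 e - {0} \<subseteq> X"
  shows "\<not> bounded (inverse ` X)"
proof
  assume "bounded (inverse ` X)"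
  then obtain M where M: "\<And>x. x \<in> X \<Longrightarrow> cmod (inverse x) \<le> M" "M > 0"
    by (auto simp: bounded_pos)
  \<comment> \<open>A positive real in the punctured ball whose inverse is at least
    \<open>2 * M\<close>.\<close>
  define t where "t = min (e / 2) (1 / (2 * M))"
  have t: "0 < t" "t < e" "t \<le> 1 / (2 * M)"
    using M(2) assms(1) by (auto simp: t_def min_def)
  then have "complex_of_real t \<in> X"
    using assms(2) by (auto intro!: subsetD[OF assms(2)])
  then have "1 \<le> M * t"
    using M(1)[of "complex_of_real t"] t(1) by (simp add: norm_inverse norm_divide field_simps)
  also have "\<dots> \<le> M * (1 / (2 * M))"
    using M(2) t(3) by (intro mult_left_mono) auto
  finally show False
    using M(2) by simp
qed

text \<open>The complementary components of \<open>inverse ` frontier H\<close> on the Riemann sphere are the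
  images of the two components of the complement of \<open>frontier H\<close>. The one from outside \<open>H\<close>
  contains \<open>0\<close>, the image of \<open>\<infinity>\<close>; the point \<open>0\<close>, which \<open>inverse\<close> fixes in HOL, is removed from the other one.\<close>

locale convex_body =
  fixes H :: "complex set"
  assumes compact: "compact H" and convex: "convex H" and interior: "interior H \<noteq> {}"
    and zero: "0 \<notin> frontier H"
begin

definition inn :: "complex set" where "inn = inverse ` (interior H - {0})"
definition out :: "complex set" where "out = insert 0 (inverse ` (- H))"

lemma frontier_eq: "frontier H = H - interior H"
  using compact by (simp add: frontier_def compact_imp_closed)

lemma zero_cases: "0 \<in> interior H \<or> 0 \<notin> H"
  using zero by (auto simp: frontier_eq)

lemma mem_inn: "w \<in> inn \<longleftrightarrow> w \<noteq> 0 \<and> inverse w \<in> interior H"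
  by (auto simp: inn_def mem_inverse_image)

lemma mem_out: "w \<in> out \<longleftrightarrow> w = 0 \<or> inverse w \<notin> H"
  by (auto simp: out_def mem_inverse_image)

lemma inn_Int_out: "inn \<inter> out = {}"
  using interior_subset[of H] by (auto simp: mem_inn mem_out)

lemma Compl_curve: "- (inverse ` frontier H) = inn \<union> out"
  using zero_cases interior_subset[of H]
  by (auto simp: mem_inn mem_out mem_inverse_image frontier_eq)

lemma open_inn: "open inn"
  unfolding inn_def by (intro open_inverse_image open_delete) auto

lemma connected_inn: "connected inn"
  unfolding inn_def
  by (intro connected_continuous_image continuous_on_cinverse connected_open_delete
      convex_connected convex_interior convex) auto

text \<open>As \<open>H\<close> is bounded, inverses of tiny nonzero points lie outside
  \<open>H\<close>. So adding the single point 0 amounts to adding a full ball, which makes openness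
  and connectedness of \<open>out\<close> accessible.\<close>

lemma out_eq:
  obtains r where "r > 0" "out = inverse ` (- H - {0}) \<union> ball 0 r"
proof -
  obtain R where R: "R > 0" "\<And>x. x \<in> H \<Longrightarrow> cmod x \<le> R"
    using compact_imp_bounded[OF compact] by (auto simp: bounded_pos)
  have "w = 0 \<or> inverse w \<notin> H" if "cmod w < inverse R" for w
  proof (rule disjCI)
    assume "\<not> inverse w \<notin> H"
    then have le: "inverse (cmod w) \<le> R"
      using R(2) by (force simp flip: norm_inverse)
    show "w = 0"
    proof (rule ccontr)
      assume "w \<noteq> 0"
      then have "inverse R \<le> cmod w"
        using le le_imp_inverse_le[OF le] by simp
      with that show False
        by simp
    qed
  qed
  then have "out = inverse ` (- H - {0}) \<union> ball 0 (inverse R)"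
    using R(1) by (auto simp: mem_out mem_inverse_image)
  with R(1) that show ?thesis
    by (metis positive_imp_inverse_positive)
qed

lemma open_out: "open out"
proof -
  obtain r where "r > 0" "out = inverse ` (- H - {0}) \<union> ball 0 r"
    by (rule out_eq)
  then show ?thesis
    using compact_imp_closed[OF compact] by (auto intro!: open_inverse_image open_delete)
qed

text \<open>The complement of a bounded convex set in the plane is connected, and so is its inverted
  image; it overlaps the ball around 0.\<close>

lemma connected_out: "connected out"
proof -
  obtain r where r: "r > 0" and out: "out = inverse ` (- H - {0}) \<union> ball 0 r"
    by (rule out_eq)
  have "connected (- H)"
    using compact convex by (intro connected_complement_bounded_convex compact_imp_bounded) auto
  then have "connected (- H - {0})"
    using compact_imp_closed[OF compact] by (intro connected_open_delete) auto
  then have "connected (inverse ` (- H - {0}))"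
    by (intro connected_continuous_image continuous_on_cinverse) auto
  moreover have "complex_of_real (r / 2) \<in> inverse ` (- H - {0}) \<inter> ball 0 r"
  proof -
    have "complex_of_real (r / 2) \<in> ball 0 r"
      using r by auto
    moreover from this have "complex_of_real (r / 2) \<in> out"
      by (auto simp: out)
    ultimately show ?thesis
      using r by (simp add: mem_out mem_inverse_image)
  qed
  then have "inverse ` (- H - {0}) \<inter> ball 0 r \<noteq> {}"
    by blast
  ultimately show ?thesis
    unfolding out by (intro connected_Un connected_ball)
qed

text \<open>Away from 0 inversion keeps the compact body bounded, while a neighbourhood of 0 in the
  complement is sent to infinity.\<close>

lemma sides_if_zero_notin:
  assumes "0 \<notin> H"
  shows "inside (inverse ` frontier H) = inn" "outside (inverse ` frontier H) = out"
proof -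
  have "compact (inverse ` H)"
    using compact assms by (intro compact_continuous_image continuous_on_cinverse)
  then have "bounded inn"
    using interior_subset by (auto simp: inn_def intro!: bounded_subset[OF compact_imp_bounded])
  moreover obtain e where "e > 0" "ball 0 e \<subseteq> - H"
    using assms compact_imp_closed[OF compact] by (meson ComplI open_Compl open_contains_ball)
  then have "\<not> bounded (inverse ` (- H))"
    by (intro unbounded_inverse_image) auto
  then have "\<not> bounded out"
    by (simp add: out_def)
  ultimately show "inside (inverse ` frontier H) = inn" "outside (inverse ` frontier H) = out"
    using inside_outside_eq[OF open_inn open_out inn_Int_out Compl_curve] connected_out by auto
qed

text \<open>Here inversion turns the body inside out: a ball around 0 in \<open>interior H\<close>
  makes \<open>inn\<close> unbounded, and everything outside that ball has a bounded image.\<close>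

lemma sides_if_zero_in:
  assumes "0 \<in> H"
  shows "inside (inverse ` frontier H) = out" "outside (inverse ` frontier H) = inn"
proof -
  have "0 \<in> interior H"
    using assms zero_cases by simp
  then obtain e where e: "e > 0" "ball 0 e \<subseteq> interior H"
    by (meson open_contains_ball open_interior)
  then have "\<not> bounded inn"
    unfolding inn_def by (intro unbounded_inverse_image[of e]) auto
  moreover have "bounded out"
  proof (rule boundedI)
    fix w assume w: "w \<in> out"
    show "cmod w \<le> inverse e"
    proof (cases "w = 0")
      case False
      then have "inverse w \<notin> ball 0 e"
        using w e interior_subset[of H] by (auto simp: mem_out)
      then have "e \<le> inverse (cmod w)"
        by (simp add: norm_inverse)
      then show ?thesis
        using e(1) le_imp_inverse_le by fastforce
    qed (use e in auto)
  qed
  ultimately show "inside (inverse ` frontier H) = out" "outside (inverse ` frontier H) = inn"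
    using inside_outside_eq[OF open_out open_inn] connected_inn inn_Int_out Compl_curve
    by (auto simp: Int_commute Un_commute)
qed

text \<open>One inclusion holds because \<open>out\<close> is open and disjoint from
  \<open>inn\<close>. The other one transports, along inversion, the fact that a convex set with
  interior points lies in the closure of its interior.\<close>

lemma closure_inn: "closure inn = inverse ` (H - {0})"
proof
  have "closure inn \<subseteq> - out"
    using open_out inn_Int_out by (intro closure_minimal) auto
  then show "closure inn \<subseteq> inverse ` (H - {0})"
    by (auto simp: mem_out mem_inverse_image)
  show "inverse ` (H - {0}) \<subseteq> closure inn"
  proof
    fix w assume "w \<in> inverse ` (H - {0})"
    then obtain x where x: "w = inverse x" "x \<in> H" "x \<noteq> 0"
      by auto
    show "w \<in> closure inn"
      unfolding closure_iff_nhds_not_empty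
    proof (intro allI impI)
      fix V W assume V: "W \<subseteq> V" "open W" "w \<in> W"
      then have "open (inverse ` (W - {0}))" "x \<in> inverse ` (W - {0})"
        using x by (auto intro!: open_inverse_image simp: mem_inverse_image)
      moreover have "x \<in> closure (interior H)"
        using convex_closure_interior[OF convex interior] x(2) closure_subset by auto
      ultimately obtain y where "y \<in> inverse ` (W - {0})" "y \<in> interior H"
        unfolding closure_iff_nhds_not_empty by blast
      then have "inverse y \<in> inn \<inter> V"
        using V(1) by (auto simp: mem_inn mem_inverse_image)
      then show "inn \<inter> V \<noteq> {}"
        by auto
    qed
  qed
qed

lemma closure_out: "closure out \<subseteq> - inn"
  using open_inn inn_Int_out by (intro closure_minimal) auto

end

subsection \<open>Inverted straight-line drawings\<close>

lemma crosses_at_mem: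
  assumes "crosses_at A B p"
  shows "p \<in> A" "p \<in> B"
proof -
  obtain U h k where U: "p \<in> U" "h p = 0" and hom: "homeomorphism U (ball 0 1) h k"
    and im: "h ` (A \<inter> U) = {z \<in> ball 0 1. Im z = 0}" "h ` (B \<inter> U) = {z \<in> ball 0 1. Re z = 0}"
    using assms unfolding crosses_at_def by blast
  have *: "p \<in> S" if "0 \<in> h ` (S \<inter> U)" for S
    using that U homeomorphism_apply1[OF hom] by (metis IntD1 IntD2 imageE)
  show "p \<in> A" "p \<in> B"
    by (rule *, simp add: im)+
qed

lemma segment_collinear: "x \<in> closed_segment a b \<Longrightarrow> collinear {a, b, x}"
  for a :: complex
  using collinear_closed_segment[of a b] by (rule collinear_subset) auto

text \<open>Two distinct common points would span a line containing \<open>a\<close>,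
  \<open>b\<close> and \<open>c\<close>.\<close>

lemma two_lines_meet_once:
  fixes a b c d :: complex
  assumes "\<not> collinear {a, b, c}" "c \<noteq> d"
    and p: "collinear {a, b, p}" "collinear {c, d, p}" and q: "collinear {a, b, q}" "collinear {c, d, q}"
  shows "p = q"
proof (rule ccontr)
  assume "p \<noteq> q"
  have "a \<noteq> b"
    using assms(1) by auto
  then have ab: "collinear {a, b, p, q}"
    using collinear_triples[of a b "{p, q}"] p(1) q(1) by simp
  have cd: "collinear {c, d, p, q}"
    using collinear_triples[OF \<open>c \<noteq> d\<close>, of "{p, q}"] p(2) q(2) by simp
  have "collinear {p, q, a}" "collinear {p, q, b}" "collinear {p, q, c}"
    using collinear_subset[OF ab] collinear_subset[OF cd] by simp_all
  then have "collinear {p, q, a, b, c}"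
    using collinear_triples[OF \<open>p \<noteq> q\<close>, of "{a, b, c}"] by simp
  then have "collinear {a, b, c}"
    by (rule collinear_subset) auto
  with assms(1) show False ..
qed

lemma open_segment_param:
  assumes "q \<in> closed_segment a b" "q \<noteq> a" "q \<noteq> (b :: complex)"
  obtains s where "0 < s" "s < 1" "q = a + s *\<^sub>R (b - a)"
proof -
  obtain s where s: "0 \<le> s" "s \<le> 1" "q = (1 - s) *\<^sub>R a + s *\<^sub>R b"
    using assms(1) by (auto simp: in_segment)
  moreover have "s \<noteq> 0" "s \<noteq> 1"
    using s assms(2,3) by auto
  ultimately show ?thesis
    using that[of s] by (auto simp: algebra_simps)
qed

text \<open>Conditions on a straight-line drawing under which its inversion is a topological
  drawing: no edge passes through 0, which goes to infinity. Concurrency is excluded for pairwise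
  disjoint edges only, since edges with a common vertex never cross.\<close>

locale general_position =
  fixes m :: nat and f :: "nat \<Rightarrow> complex"
  assumes three: "3 \<le> m"
    and not_collinear: "i < m \<Longrightarrow> j < m \<Longrightarrow> k < m \<Longrightarrow> i \<noteq> j \<Longrightarrow> j \<noteq> k \<Longrightarrow> i \<noteq> k \<Longrightarrow>
      \<not> collinear {f i, f j, f k}"
    and zero_notin_edge: "e \<in> nsets {..<m} 2 \<Longrightarrow> 0 \<notin> convex hull (f ` e)"
    and nonconcurrent: "d \<in> nsets {..<m} 2 \<Longrightarrow> e \<in> nsets {..<m} 2 \<Longrightarrow> g \<in> nsets {..<m} 2 \<Longrightarrow>
      d \<inter> e = {} \<Longrightarrow> d \<inter> g = {} \<Longrightarrow> e \<inter> g = {} \<Longrightarrow>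
      convex hull (f ` d) \<inter> convex hull (f ` e) \<inter> convex hull (f ` g) = {}"
begin

definition D :: drawing where
  "D = \<lparr>vert = \<lambda>i. inverse (f i), edge = \<lambda>e. inverse ` (convex hull (f ` e))\<rparr>"

lemma vert_D [simp]: "vert D i = inverse (f i)"
  and edge_D [simp]: "edge D e = inverse ` (convex hull (f ` e))"
  by (simp_all add: D_def)

lemma hull_pair: "convex hull (f ` {i, j}) = closed_segment (f i) (f j)"
  by (simp add: segment_convex_hull)

text \<open>Two coinciding points would be collinear with any third vertex, which exists by
  \<open>three\<close>.\<close>

lemma f_eq_iff:
  assumes "i < m" "j < m"
  shows "f i = f j \<longleftrightarrow> i = j"
proof
  assume "f i = f j"
  have "card {i, j} < m"
    using three card_insert_le_m1[of 2 "{j}" i] by simp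
  then obtain k where "k < m" "k \<notin> {i, j}"
    by (metis card_lessThan card_mono finite.emptyI finite_insert leD lessThan_iff subsetI)
  then show "i = j"
    using not_collinear[of i j k] assms \<open>f i = f j\<close> by auto
qed simp

lemma inj: "inj_on f {..<m}"
  by (auto simp: inj_on_def f_eq_iff)

lemma f_nonzero:
  assumes "i < m"
  shows "f i \<noteq> 0"
proof -
  obtain j where "j < m" "j \<noteq> i"
    using that[of 0] that[of 1] three by (cases "i = 0") auto
  then have "{i, j} \<in> nsets {..<m} 2"
    using assms by simp
  then show ?thesis
    using zero_notin_edge hull_inc[of "f i" "f ` {i, j}"] by fastforce
qed

lemma vertex_in_edge:
  assumes "e \<in> nsets {..<m} 2" "i < m" "f i \<in> convex hull (f ` e)"
  shows "i \<in> e"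
proof (rule ccontr)
  assume "i \<notin> e"
  obtain j k where e: "e = {j, k}" "j < m" "k < m" "j \<noteq> k"
    using nsets2_E[OF assms(1)] by auto
  then have "collinear {f j, f k, f i}"
    using assms(3) segment_collinear unfolding e(1) hull_pair by blast
  with not_collinear[of j k i] e assms(2) \<open>i \<notin> e\<close> show False
    by auto
qed

text \<open>Distinct edges have a vertex \<open>k\<close> of one that is not in the other, and
  \<open>f k\<close> is off the line of the other edge.\<close>

lemma edges_meet_once:
  assumes "d \<in> nsets {..<m} 2" "e \<in> nsets {..<m} 2" "d \<noteq> e"
    and "p \<in> convex hull (f ` d)" "p \<in> convex hull (f ` e)"
    and "q \<in> convex hull (f ` d)" "q \<in> convex hull (f ` e)"
  shows "p = q"
proof -
  obtain i j where d: "d = {i, j}" "i < m" "j < m" "i \<noteq> j"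
    using nsets2_E[OF assms(1)] by auto
  obtain k where k: "k \<in> e" "k \<notin> d"
  proof -
    have "card d = 2" "card e = 2" "finite d" "finite e"
      using assms by (auto simp: nsets_def)
    then have "\<not> e \<subseteq> d"
      using \<open>d \<noteq> e\<close> by (metis card_subset_eq)
    then show ?thesis
      using that by auto
  qed
  then obtain l where e: "e = {k, l}" "k < m" "l < m" "k \<noteq> l"
    using assms(2) by (auto elim!: nsets2_E simp: insert_commute)
  have nc: "\<not> collinear {f i, f j, f k}"
    using not_collinear[of i j k] d e k by auto
  have ne: "f k \<noteq> f l"
    using f_eq_iff e by simp
  have on: "collinear {f i, f j, x}" "collinear {f k, f l, x}"
    if "x \<in> convex hull (f ` d)" "x \<in> convex hull (f ` e)" for x
    using that segment_collinear unfolding d(1) e(1) hull_pair by blast+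
  show "p = q"
    using two_lines_meet_once[OF nc ne on(1) on(2) on(1) on(2)] assms(4-7) by blast
qed

lemma shared_vertex:
  assumes "d \<in> nsets {..<m} 2" "e \<in> nsets {..<m} 2" "d \<noteq> e" "i \<in> d" "i \<in> e"
    and "p \<in> convex hull (f ` d)" "p \<in> convex hull (f ` e)"
  shows "p = f i"
  using edges_meet_once[OF assms(1-3) assms(6,7), of "f i"] assms(4,5) by (simp add: hull_inc)

text \<open>No vertex lies on an edge not incident to it, so \<open>q\<close> is an inner point of
  both segments. Parallel directions would put \<open>f k\<close> on the line through
  \<open>f i\<close> and \<open>f j\<close>.\<close>

lemma cross_if_disjoint:
  assumes "d \<in> nsets {..<m} 2" "e \<in> nsets {..<m} 2" "d \<inter> e = {}"
    and q: "q \<in> convex hull (f ` d)" "q \<in> convex hull (f ` e)"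
  shows "crosses_at (edge D d) (edge D e) (inverse q)"
proof -
  obtain i j where d: "d = {i, j}" "i < m" "j < m" "i \<noteq> j"
    using nsets2_E[OF assms(1)] by auto
  obtain k l where e: "e = {k, l}" "k < m" "l < m" "k \<noteq> l"
    using nsets2_E[OF assms(2)] by auto
  have qs: "q \<in> closed_segment (f i) (f j)" "q \<in> closed_segment (f k) (f l)"
    using q unfolding d e hull_pair by auto
  have ne: "q \<noteq> f x" if "x \<in> d \<union> e" for x
  proof
    assume "q = f x"
    have "x < m"
      using that assms(1,2) by (auto simp: nsets_def)
    then have "x \<in> d" "x \<in> e"
      using vertex_in_edge assms(1,2) q unfolding \<open>q = f x\<close> by simp_all
    then show False
      using assms(3) by auto
  qed
  obtain s where s: "0 < s" "s < 1" "q = f i + s *\<^sub>R (f j - f i)"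
    using open_segment_param[OF qs(1)] ne[of i] ne[of j] unfolding d(1) by blast
  obtain t where t: "0 < t" "t < 1" "q = f k + t *\<^sub>R (f l - f k)"
    using open_segment_param[OF qs(2)] ne[of k] ne[of l] unfolding e(1) by blast
  have "cross (f j - f i) (f l - f k) \<noteq> 0"
  proof
    assume 0: "cross (f j - f i) (f l - f k) = 0"
    have eq: "f k - f i = s *\<^sub>R (f j - f i) - t *\<^sub>R (f l - f k)"
      using s(3) t(3) by (simp add: algebra_simps)
    have "cross (f j - f i) (f k - f i) = - t * cross (f j - f i) (f l - f k)"
      unfolding eq by (simp add: cross_def algebra_simps)
    then have "collinear {f i, f j, f k}"
      using 0 by (simp add: collinear_iff_cross)
    then show False
      using not_collinear[of i j k] d(2-4) e(2) assms(3) unfolding d(1) e(1) by simp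
  qed
  moreover have "q \<noteq> 0"
    using zero_notin_edge[OF assms(1)] q(1) by metis
  ultimately show ?thesis
    unfolding edge_D d(1) e(1) hull_pair
    by (rule crosses_at_inverse_segments[OF s(3) t(3) s(1,2) t(1,2)])
qed

text \<open>The only common point is the shared vertex, an end point of the first edge, where no
  crossing is possible.\<close>

lemma not_cross_if_shared:
  assumes "d \<in> nsets {..<m} 2" "e \<in> nsets {..<m} 2" "d \<noteq> e" "d \<inter> e \<noteq> {}"
  shows "\<not> crosses_at (edge D d) (edge D e) p"
proof
  assume cr: "crosses_at (edge D d) (edge D e) p"
  obtain i where i: "i \<in> d" "i \<in> e"
    using assms(4) by auto
  then obtain j where d: "d = {i, j}" "i < m" "j < m" "i \<noteq> j"
    using nsets2_E[OF assms(1)] by (auto simp: insert_commute)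
  have "p \<in> edge D d" "p \<in> edge D e"
    using crosses_at_mem[OF cr] by auto
  then have "inverse p = f i"
    using shared_vertex[OF assms(1-3) i] by (auto simp: mem_inverse_image)
  then have "p = inverse (f i)"
    by (metis inverse_inverse_eq)
  moreover have "0 \<notin> closed_segment (f i) (f j)"
    using zero_notin_edge[OF assms(1)] unfolding d(1) hull_pair .
  ultimately show False
    using cr not_crosses_at_endpoint[of "f i" "f j" "edge D e"] f_eq_iff[OF d(2,3)] d(4)
    unfolding edge_D d(1) hull_pair by simp
qed

lemma D_edge_arc:
  assumes "e \<in> nsets {..<m} 2"
  shows "\<exists>g. arc g \<and> path_image g = edge D e \<and> {pathstart g, pathfinish g} = vert D ` e"
proof -
  obtain i j where e: "e = {i, j}" "i < m" "j < m" "i \<noteq> j"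
    using nsets2_E[OF assms] by auto
  let ?g = "inverse \<circ> linepath (f i) (f j)"
  have "0 \<notin> closed_segment (f i) (f j)"
    using zero_notin_edge[OF assms] unfolding e(1) hull_pair .
  then have "path ?g"
    by (intro path_continuous_image continuous_on_cinverse) auto
  moreover have "arc (linepath (f i) (f j))"
    using f_eq_iff e by simp
  then have "inj_on ?g {0..1}"
    unfolding arc_def by (intro comp_inj_on inj_cinverse) auto
  ultimately have "arc ?g"
    by (simp add: arc_def)
  moreover have "path_image ?g = edge D e" "{pathstart ?g, pathfinish ?g} = vert D ` e"
    unfolding edge_D e(1) hull_pair by (simp_all add: path_image_compose pathstart_compose pathfinish_compose)
  ultimately show ?thesis
    by blast
qed

lemma topological_drawing_D: "topological_drawing m D"
  unfolding topological_drawing_def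
proof (intro conjI ballI impI notI)
  show "inj_on (vert D) {..<m}"
    using inj by (simp add: inj_on_def)
next
  fix e assume e: "e \<in> nsets {..<m} 2"
  show "\<exists>g. arc g \<and> path_image g = edge D e \<and> {pathstart g, pathfinish g} = vert D ` e"
    using e by (rule D_edge_arc)
  have "i \<in> e" if "i < m" "inverse (f i) \<in> edge D e" for i
    using that e by (intro vertex_in_edge) (auto simp: mem_inverse_image)
  moreover have "e \<subseteq> {..<m}"
    using e by (auto simp: nsets_def)
  ultimately show "edge D e \<inter> vert D ` {..<m} = vert D ` e"
    by (force simp: mem_inverse_image intro: hull_inc)
next
  fix d e p q
  assume "d \<in> nsets {..<m} 2" "e \<in> nsets {..<m} 2" "d \<noteq> e"
    and "p \<in> edge D d \<inter> edge D e" "q \<in> edge D d \<inter> edge D e"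
  then have "inverse p = inverse q"
    by (intro edges_meet_once) (auto simp: mem_inverse_image)
  then show "p = q"
    by simp
next
  fix d e p
  assume de: "d \<in> nsets {..<m} 2" "e \<in> nsets {..<m} 2" "d \<noteq> e"
    and p: "p \<in> edge D d \<inter> edge D e"
  then obtain q where q: "p = inverse q" "q \<in> convex hull (f ` d)" "q \<in> convex hull (f ` e)"
    by (metis IntE edge_D imageE mem_inverse_image)
  show "p \<in> vert D ` (d \<inter> e) \<or> crosses_at (edge D d) (edge D e) p"
  proof (cases "d \<inter> e = {}")
    case True
    then show ?thesis
      using cross_if_disjoint[OF de(1,2) True q(2,3)] q(1) by simp
  next
    case False
    then obtain i where i: "i \<in> d" "i \<in> e"
      by auto
    then have "p = vert D i"
      using shared_vertex[OF de i q(2,3)] q(1) by simp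
    then show ?thesis
      using i by blast
  qed
next
  fix d e g
  assume S: "d \<in> nsets {..<m} 2" "e \<in> nsets {..<m} 2" "g \<in> nsets {..<m} 2"
    and ne: "d \<noteq> e \<and> d \<noteq> g \<and> e \<noteq> g"
    and "\<exists>p. crosses_at (edge D d) (edge D e) p \<and> crosses_at (edge D d) (edge D g) p \<and>
      crosses_at (edge D e) (edge D g) p"
  then obtain p where p: "crosses_at (edge D d) (edge D e) p" "crosses_at (edge D d) (edge D g) p"
    "crosses_at (edge D e) (edge D g) p"
    by blast
  \<comment> \<open>Edges that cross share no vertex, so a triple crossing would contradict
    \<open>nonconcurrent\<close>.\<close>
  then have "d \<inter> e = {}" "d \<inter> g = {}" "e \<inter> g = {}"
    using not_cross_if_shared S ne by blast+
  moreover have "p \<in> edge D d" "p \<in> edge D e" "p \<in> edge D g"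
    using crosses_at_mem p by blast+
  then have "inverse p \<in> convex hull (f ` d) \<inter> convex hull (f ` e) \<inter> convex hull (f ` g)"
    by (auto simp: mem_inverse_image)
  ultimately show False
    using nonconcurrent S by blast
qed

section \<open>Sides of triangles and cell-convexity\<close>

lemma triangle_body:
  assumes "T \<in> nsets {..<m} 3"
  shows "convex_body (convex hull (f ` T))"
    and "triangle_curve D T = inverse ` frontier (convex hull (f ` T))"
proof -
  obtain i j k where T: "T = {i, j, k}" "i < m" "j < m" "k < m" "i \<noteq> j" "j \<noteq> k" "i \<noteq> k"
    using assms by (auto simp: nsets_3_eq)
  have fr: "frontier (convex hull (f ` T)) =
      closed_segment (f i) (f j) \<union> closed_segment (f j) (f k) \<union> closed_segment (f k) (f i)"
    unfolding T using frontier_of_triangle[of "f i" "f j" "f k"] by simp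
  have "nsets T 2 = {{i, j}, {j, k}, {k, i}}"
    unfolding T nsets_2_eq using T(5-7) by auto
  then show "triangle_curve D T = inverse ` frontier (convex hull (f ` T))"
    unfolding fr triangle_curve_def by (simp add: image_Un Un_assoc segment_convex_hull)
  show "convex_body (convex hull (f ` T))"
  proof
    show "compact (convex hull (f ` T))"
      using T by (intro compact_convex_hull finite_imp_compact) simp
    show "0 \<notin> frontier (convex hull (f ` T))"
      unfolding fr hull_pair[symmetric]
      using zero_notin_edge[of "{i, j}"] zero_notin_edge[of "{j, k}"] zero_notin_edge[of "{k, i}"] T by simp
    show "interior (convex hull (f ` T)) \<noteq> {}"
    proof
      assume "interior (convex hull (f ` T)) = {}"
      then have "interior (convex hull {f i, f j, f k}) = {}"
        unfolding T by simp
      then have "{v. \<exists>x y z. 0 < x \<and> 0 < y \<and> 0 < z \<and> x + y + z = 1 \<and> x *\<^sub>R f i + y *\<^sub>R f j + z *\<^sub>R f k = v} = {}"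
        using interior_convex_hull_3_minimal[of "f i" "f j" "f k"] not_collinear[of i j k] T by simp
      \<comment> \<open>The centroid is an interior point.\<close>
      moreover have "(0::real) < 1/3 \<and> (0::real) < 1/3 \<and> (0::real) < 1/3 \<and> 1/3 + 1/3 + 1/3 = (1::real) \<and> 
         (1/3) *\<^sub>R f i + (1/3) *\<^sub>R f j + (1/3) *\<^sub>R f k = (1/3) *\<^sub>R f i + (1/3) *\<^sub>R f j + (1/3) *\<^sub>R f k"
        by simp
      ultimately show False
        by blast
    qed
  qed simp
qed

lemma bounded_side_zero_notin:
  assumes T: "T \<in> nsets {..<m} 3" and 0: "0 \<notin> convex hull (f ` T)"
  shows "bounded_side D T = inverse ` (convex hull (f ` T))"
    and "inverse ` interior (convex hull (f ` T)) \<subseteq> interior (bounded_side D T)"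
proof -
  interpret convex_body "convex hull (f ` T)"
    using T by (rule triangle_body)
  show eq: "bounded_side D T = inverse ` (convex hull (f ` T))"
    unfolding bounded_side_def triangle_body(2)[OF T] sides_if_zero_notin[OF 0] closure_inn
    using 0 by simp
  show "inverse ` interior (convex hull (f ` T)) \<subseteq> interior (bounded_side D T)"
    unfolding eq using 0 interior_subset
    by (intro interior_maximal open_inverse_image image_mono) auto
qed

text \<open>The bounded side is the closure of \<open>out\<close>. It avoids \<open>inn\<close>,
  which bounds it from above, and \<open>out\<close> is open, which bounds its interior from
  below.\<close>

lemma bounded_side_zero_in:
  assumes T: "T \<in> nsets {..<m} 3" and 0: "0 \<in> convex hull (f ` T)"
  shows "w \<in> bounded_side D T \<Longrightarrow> w = 0 \<or> inverse w \<notin> interior (convex hull (f ` T))"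
    and "w = 0 \<or> inverse w \<notin> convex hull (f ` T) \<Longrightarrow> w \<in> interior (bounded_side D T)"
proof -
  interpret convex_body "convex hull (f ` T)"
    using T by (rule triangle_body)
  have eq: "bounded_side D T = closure out"
    unfolding bounded_side_def triangle_body(2)[OF T] sides_if_zero_in[OF 0] ..
  show "w = 0 \<or> inverse w \<notin> interior (convex hull (f ` T))" if "w \<in> bounded_side D T"
    using that closure_out unfolding eq by (auto simp: mem_inn)
  have "out \<subseteq> interior (bounded_side D T)"
    unfolding eq by (intro interior_maximal open_out closure_subset)
  then show "w \<in> interior (bounded_side D T)" if "w = 0 \<or> inverse w \<notin> convex hull (f ` T)"
    using that mem_out by auto
qed

text \<open>The special cell is the one of 0. It is connected and avoids every triangle curve, so it
  lies in \<open>out\<close> for each triangle. A side not containing it is therefore the inverted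
  triangle body, where convexity before inversion keeps the edges inside.\<close>

lemma cell_convex_D: "cell_convex m D"
proof -
  define G where "G = vert D ` {..<m} \<union> (\<Union>e \<in> nsets {..<m} 2. edge D e)"
  have zero: "0 \<notin> G"
    using f_nonzero zero_notin_edge by (auto simp: G_def mem_inverse_image)
    define c where "c = connected_component_set (- G) 0"
    have c: "c \<in> cells m D"
      unfolding cells_def c_def G_def[symmetric] using zero by (simp add: componentsI)
    have "0 \<in> c"
      using zero by (simp add: c_def)
    have "convex_side m D S" if T: "T \<in> nsets {..<m} 3" and S: "S \<in> {bounded_side D T, unbounded_side D T}"
      and cS: "\<not> c \<subseteq> S" for T S
    proof -
      let ?H = "convex hull (f ` T)"
      interpret convex_body ?H
        using T by (rule triangle_body)
      have curve: "triangle_curve D T = inverse ` frontier ?H"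
        using T by (rule triangle_body)
      have "c \<subseteq> - G"
        by (simp add: c_def connected_component_subset)
      moreover have "T \<subseteq> {..<m}"
        using T by (simp add: nsets_def)
      then have "triangle_curve D T \<subseteq> G"
        using nsets_mono[of T "{..<m}" 2] unfolding triangle_curve_def G_def by blast
      ultimately have "c \<subseteq> - triangle_curve D T"
        by blast
      then have "c \<subseteq> inn \<union> out"
        unfolding curve Compl_curve .
      moreover have "connected c"
        by (simp add: c_def connected_connected_component)
      moreover have "0 \<in> out"
        by (simp add: mem_out)
      ultimately have "c \<subseteq> out"
        using connectedD[of c out inn] open_inn open_out inn_Int_out \<open>0 \<in> c\<close> by blast
      then have "S \<noteq> closure out"
        using cS closure_subset by blast
      moreover have "S = closure inn \<or> S = closure out"
        using S sides_if_zero_in sides_if_zero_notin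
        unfolding bounded_side_def unbounded_side_def curve by (cases "0 \<in> ?H") auto
      ultimately have "S = closure inn"
        by blast
      then have S_eq: "S = inverse ` (?H - {0})"
        by (simp add: closure_inn)
      show ?thesis
        unfolding convex_side_def
      proof (intro ballI impI)
        fix e assume e: "e \<in> nsets {..<m} 2" "vert D ` e \<subseteq> S"
        then have "f ` e \<subseteq> ?H"
          by (auto simp: S_eq mem_inverse_image)
        then have "convex hull (f ` e) \<subseteq> ?H"
          by (rule hull_minimal) simp
        then show "edge D e \<subseteq> S"
          using zero_notin_edge[OF e(1)] by (auto simp: S_eq)
      qed
    qed
    with c show ?thesis
      unfolding cell_convex_def by blast
qed

end

subsection \<open>Existence of points in general position\<close>

lemma negligible_collinear:
  fixes a b :: complex
  assumes "a \<noteq> b"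
  shows "negligible {z. collinear {a, b, z}}"
proof -
  define u where "u = b - a"
  \<comment> \<open>The line is a hyperplane whose normal is \<open>u\<close> rotated by a right
    angle.\<close>
  have "cross u (z - a) = Complex (- Im u) (Re u) \<bullet> z - cross u a" for z
    by (simp add: cross_def inner_complex_def algebra_simps)
  then have "{z. collinear {a, b, z}} = {z. Complex (- Im u) (Re u) \<bullet> z = cross u a}"
    by (simp add: collinear_iff_cross u_def)
  moreover have "Complex (- Im u) (Re u) \<noteq> 0"
    using assms by (auto simp: u_def complex_eq_iff)
  ultimately show ?thesis
    using negligible_hyperplane[of "Complex (- Im u) (Re u)" "cross u a"] by simp
qed

text \<open>If the two points of an edge coincide, this is the whole plane, so requiring
  \<open>0 \<notin> line_of f e\<close> also forces distinct points.\<close>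

definition line_of :: "(nat \<Rightarrow> complex) \<Rightarrow> nat set \<Rightarrow> complex set" where
  "line_of f e = {q. collinear (insert q (f ` e))}"

text \<open>The invariant of the point-by-point construction. It asks for more than \<open>general_position\<close>,
  with lines in place of segments, so that each new point only has to avoid finitely many lines.\<close>

definition generic :: "nat \<Rightarrow> (nat \<Rightarrow> complex) \<Rightarrow> bool" where
  "generic k f \<longleftrightarrow> (\<forall>i<k. f i \<noteq> 0) \<and>
     (\<forall>e \<in> nsets {..<k} 2. 0 \<notin> line_of f e) \<and>
     (\<forall>i<k. \<forall>e \<in> nsets {..<k} 2. i \<notin> e \<longrightarrow> f i \<notin> line_of f e) \<and>
     (\<forall>d \<in> nsets {..<k} 2. \<forall>e \<in> nsets {..<k} 2. \<forall>g \<in> nsets {..<k} 2.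
        d \<inter> e = {} \<longrightarrow> d \<inter> g = {} \<longrightarrow> e \<inter> g = {} \<longrightarrow> line_of f d \<inter> line_of f e \<inter> line_of f g = {})"

lemma line_of_pair: "line_of f {i, j} = {q. collinear {f i, f j, q}}"
  by (simp add: line_of_def insert_commute)

lemma line_of_upd: "k \<notin> e \<Longrightarrow> line_of (f(k := z)) e = line_of f e"
  unfolding line_of_def by (subst image_cong[OF refl, of e _ f]) auto

lemma nsets_Suc_cases:
  assumes "e \<in> nsets {..<Suc k} 2"
  obtains "e \<in> nsets {..<k} 2" "k \<notin> e" | i where "i < k" "e = {i, k}"
proof -
  obtain x y where e: "e = {x, y}" "x < Suc k" "y < Suc k" "x \<noteq> y"
    using nsets2_E[OF assms] by auto
  then consider "x < k" "y < k" | "x = k" "y < k" | "x < k" "y = k"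
    by linarith
  then show ?thesis
  proof cases
    case 1
    with e show ?thesis
      by (intro that(1)) auto
  next
    case 2
    with e show ?thesis
      by (intro that(2)[of y]) auto
  next
    case 3
    with e show ?thesis
      by (intro that(2)[of x]) auto
  qed
qed

lemma generic_distinct:
  assumes "generic k f" "i < k" "j < k" "i \<noteq> j"
  shows "f i \<noteq> f j"
proof
  assume "f i = f j"
  then have "0 \<in> line_of f {i, j}"
    by (simp add: line_of_def)
  with assms show False
    unfolding generic_def by simp
qed

text \<open>The lines of \<open>d\<close> and \<open>e\<close> meet in at most one point
  \<open>q\<close>, and \<open>f c\<close> differs from it. So a new point \<open>z\<close> causes
  concurrency only on the line through \<open>f c\<close> and \<open>q\<close>.\<close>

lemma negligible_concurrent:
  assumes gen: "generic k f" and "d \<in> nsets {..<k} 2" "e \<in> nsets {..<k} 2" "d \<inter> e = {}"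
    and c: "c < k" "c \<notin> d"
  shows "negligible {z. \<exists>q \<in> line_of f d \<inter> line_of f e. collinear {f c, z, q}}" (is "negligible ?N")
proof -
  obtain i j where d: "d = {i, j}" "i < k" "j < k" "i \<noteq> j"
    using nsets2_E[OF assms(2)] by auto
  obtain a b where e: "e = {a, b}" "a < k" "b < k" "a \<noteq> b"
    using nsets2_E[OF assms(3)] by auto
  have "a \<notin> d"
    using assms(4) unfolding e(1) by simp
  have off: "f x \<notin> line_of f d" if "x < k" "x \<notin> d" for x
    using gen that assms(2) unfolding generic_def by blast
  have ab: "f a \<noteq> f b"
    by (rule generic_distinct[OF gen e(2-4)])
  have nc: "\<not> collinear {f i, f j, f a}"
    using off[OF e(2) \<open>a \<notin> d\<close>] unfolding d(1) line_of_pair by simp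
  show ?thesis
  proof (cases "line_of f d \<inter> line_of f e = {}")
    case False
    then obtain q where q: "q \<in> line_of f d" "q \<in> line_of f e"
      by auto
    have uniq: "p = q" if "p \<in> line_of f d \<inter> line_of f e" for p
      using two_lines_meet_once[OF nc ab] that q unfolding d(1) e(1) line_of_pair by simp
    have "f c \<noteq> q"
      using off[OF c] q(1) by metis
    then have "negligible {z. collinear {f c, q, z}}"
      by (rule negligible_collinear)
    moreover have "?N \<subseteq> {z. collinear {f c, q, z}}"
      using uniq by (auto simp: insert_commute)
    ultimately show ?thesis
      by (rule negligible_subset)
  qed simp
qed

text \<open>The bad positions of the new point form a null set, which cannot contain a nonempty open
  set.\<close>

lemma generic_extend:
  assumes gen: "generic k f" and U: "open U" "U \<noteq> {}"
  obtains z where "z \<in> U" "generic (Suc k) (f(k := z))"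
proof -
  let ?E = "nsets {..<k} 2"
  define I where "I = {(d, e, c) \<in> ?E \<times> ?E \<times> {..<k}. d \<inter> e = {} \<and> c \<notin> d \<and> c \<notin> e}"
  \<comment> \<open>Bad positions: 0 itself, those giving a new line through 0, those on an old
    line, and those giving a new line through the common point of two old ones.\<close>
  define N where "N = {0} \<union> (\<Union>i<k. {z. collinear {0, f i, z}}) \<union> (\<Union>e \<in> ?E. line_of f e) \<union>
    (\<Union>(d, e, c) \<in> I. {z. \<exists>q \<in> line_of f d \<inter> line_of f e. collinear {f c, z, q}})"
  have finE: "finite ?E"
    by (simp add: finite_imp_finite_nsets)
  have "finite I"
    by (rule finite_subset[of _ "?E \<times> ?E \<times> {..<k}"]) (auto simp: I_def finE)
  have "negligible (\<Union>i<k. {z. collinear {0, f i, z}})"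
    using gen by (intro negligible_Union) (auto simp: generic_def intro!: negligible_collinear)
  moreover have "negligible (line_of f e)" if eE: "e \<in> ?E" for e
  proof -
    obtain i j where e: "e = {i, j}" "i < k" "j < k" "i \<noteq> j"
      using nsets2_E[OF eE] by auto
    show ?thesis
      unfolding e(1) line_of_pair by (rule negligible_collinear[OF generic_distinct[OF gen e(2-4)]])
  qed
  then have "negligible (\<Union>e \<in> ?E. line_of f e)"
    using finE by (intro negligible_Union) auto
  moreover have "negligible (\<Union>(d, e, c) \<in> I. {z. \<exists>q \<in> line_of f d \<inter> line_of f e. collinear {f c, z, q}})"
    using \<open>finite I\<close> by (intro negligible_Union) (auto simp: I_def intro!: negligible_concurrent[OF gen, simplified])
  ultimately have "negligible N"
    unfolding N_def by (intro negligible_Un negligible_sing)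
  then have "\<not> U \<subseteq> N"
    using U open_not_negligible negligible_subset by blast
  then obtain z where z: "z \<in> U" "z \<notin> N"
    by auto
  let ?f = "f(k := z)"
  have z0: "z \<noteq> 0" and zi: "\<And>i. i < k \<Longrightarrow> \<not> collinear {0, f i, z}" and ze: "\<And>e. e \<in> ?E \<Longrightarrow> z \<notin> line_of f e"
    using z(2) by (auto simp: N_def)
  have zc: "\<not> collinear {f c, z, q}"
    if "d \<in> ?E" "e \<in> ?E" "c < k" "d \<inter> e = {}" "c \<notin> d" "c \<notin> e" "q \<in> line_of f d" "q \<in> line_of f e" for d e c q
  proof -
    have "(d, e, c) \<in> I"
      using that by (simp add: I_def)
    then show ?thesis
      using z(2) that(7,8) unfolding N_def by blast
  qed
  have line_new: "line_of ?f {i, k} = {q. collinear {f i, z, q}}" if "i < k" for i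
    using that by (simp add: line_of_pair)
  have last: "line_of ?f d \<inter> line_of ?f e \<inter> line_of ?f g = {}"
    if d: "d \<in> ?E" and e: "e \<in> ?E" and g: "g = {c, k}" "c < k" and disj: "d \<inter> e = {}" "d \<inter> g = {}" "e \<inter> g = {}" for d e g c
  proof -
    have "c \<notin> d" "k \<notin> d" "c \<notin> e" "k \<notin> e"
      using disj unfolding g(1) by auto
    then show ?thesis
      using zc[OF d e g(2) disj(1)] unfolding g(1) line_new[OF g(2)] by (auto simp: line_of_upd)
  qed
  have "generic (Suc k) ?f"
    unfolding generic_def
  proof (intro conjI allI ballI impI)
    show "?f i \<noteq> 0" if "i < Suc k" for i
      using that z0 gen by (auto simp: generic_def less_Suc_eq)
  next
    fix e assume "e \<in> nsets {..<Suc k} 2"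
    then show "0 \<notin> line_of ?f e"
    proof (cases rule: nsets_Suc_cases)
      case 1
      then show ?thesis
        using gen by (simp add: line_of_upd generic_def)
    next
      case (2 i)
      then show ?thesis
        using zi[of i] by (simp add: line_new) (simp add: insert_commute)
    qed
  next
    fix i e assume i: "i < Suc k" "i \<notin> e" and "e \<in> nsets {..<Suc k} 2"
    from this(3) show "?f i \<notin> line_of ?f e"
    proof (cases rule: nsets_Suc_cases)
      case 1
      then show ?thesis
        using gen ze i by (cases "i = k") (simp_all add: line_of_upd generic_def)
    next
      case (2 j)
      \<comment> \<open>An old point \<open>f i\<close> lies on the new line through
        \<open>f j\<close> and \<open>z\<close> only if \<open>z\<close> lies on the old line of
        \<open>{i, j}\<close>.\<close>
      then have "i < k" "i \<noteq> j" "j < k"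
        using i by auto
      then have "z \<notin> line_of f {i, j}"
        by (intro ze) simp
      then show ?thesis
        using 2 \<open>i < k\<close> by (simp add: line_new) (simp add: line_of_pair insert_commute)
    qed
  next
    fix d e g
    assume S: "d \<in> nsets {..<Suc k} 2" "e \<in> nsets {..<Suc k} 2" "g \<in> nsets {..<Suc k} 2"
      and disj: "d \<inter> e = {}" "d \<inter> g = {}" "e \<inter> g = {}"
    have old: "e \<in> ?E" if "k \<notin> e" "e \<in> nsets {..<Suc k} 2" for e
      using that(2) by (cases rule: nsets_Suc_cases) (use that(1) in auto)
    have new: "\<exists>c<k. e = {c, k}" if "k \<in> e" "e \<in> nsets {..<Suc k} 2" for e
      using that(2) by (cases rule: nsets_Suc_cases) (use that(1) in auto)
    \<comment> \<open>Pairwise disjointness allows at most one of the three edges to contain the new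
      vertex.\<close>
    consider "k \<notin> d" "k \<notin> e" "k \<notin> g" | "k \<in> g" "k \<notin> d" "k \<notin> e" | "k \<in> e" "k \<notin> d" "k \<notin> g" | "k \<in> d" "k \<notin> e" "k \<notin> g"
      using disj by blast
    then show "line_of ?f d \<inter> line_of ?f e \<inter> line_of ?f g = {}"
    proof cases
      case 1
      then show ?thesis
        using old S gen disj by (simp add: line_of_upd generic_def)
    next
      case 2
      then show ?thesis
        using last[of d e g] old S new[of g] disj by blast
    next
      case 3
      have "g \<inter> e = {}"
        using disj by blast
      with 3 show ?thesis
        using last[of d g e] old S new[of e] disj by blast
    next
      case 4
      have "e \<inter> d = {}" "g \<inter> d = {}"
        using disj by blast+
      with 4 show ?thesis
        using last[of e g d] old S new[of d] disj by blast
    qed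
  qed
  with z(1) that show ?thesis
    by blast
qed

lemma generic_exists:
  assumes "\<And>i. i < k \<Longrightarrow> open (U i) \<and> U i \<noteq> {}"
  shows "\<exists>f. (\<forall>i<k. f i \<in> U i) \<and> generic k f"
  using assms
proof (induction k)
  case 0
  have "generic 0 (\<lambda>_. 0)"
    by (auto simp: generic_def elim: nsets2_E)
  then show ?case
    by auto
next
  case (Suc k)
  then obtain f where f: "\<forall>i<k. f i \<in> U i" "generic k f"
    by auto
  obtain z where "z \<in> U k" "generic (Suc k) (f(k := z))"
    using generic_extend[OF f(2)] Suc.prems[of k] by blast
  moreover from this f(1) have "\<forall>i<Suc k. (f(k := z)) i \<in> U i"
    by (simp add: less_Suc_eq)
  ultimately show ?case
    by blast
qed

lemma general_position_generic:
  assumes gen: "generic m f" and m: "3 \<le> m"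
  shows "general_position m f"
proof
  have line: "convex hull (f ` e) \<subseteq> line_of f e" if eE: "e \<in> nsets {..<m} 2" for e
  proof -
    obtain i j where e: "e = {i, j}"
      using nsets2_E[OF eE] by blast
    show ?thesis
      unfolding e line_of_pair by (auto simp: segment_collinear segment_convex_hull[symmetric])
  qed
  show "3 \<le> m"
    by fact
  show "\<not> collinear {f i, f j, f k}" if "i < m" "j < m" "k < m" "i \<noteq> j" "j \<noteq> k" "i \<noteq> k" for i j k
  proof -
    have "f k \<notin> line_of f {i, j}"
      using gen that unfolding generic_def by simp
    then show ?thesis
      by (simp add: line_of_pair)
  qed
  show "0 \<notin> convex hull (f ` e)" if "e \<in> nsets {..<m} 2" for e
  proof -
    have "0 \<notin> line_of f e"
      using gen that unfolding generic_def by simp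
    then show ?thesis
      using line[OF that] by blast
  qed
  show "convex hull (f ` d) \<inter> convex hull (f ` e) \<inter> convex hull (f ` g) = {}"
    if "d \<in> nsets {..<m} 2" "e \<in> nsets {..<m} 2" "g \<in> nsets {..<m} 2"
      "d \<inter> e = {}" "d \<inter> g = {}" "e \<inter> g = {}" for d e g
  proof -
    have "line_of f d \<inter> line_of f e \<inter> line_of f g = {}"
      using gen that unfolding generic_def by simp
    then show ?thesis
      using line that(1-3) by blast
  qed
qed

subsection \<open>The wedges\<close>

text \<open>The \<open>r\<close>-neighbourhood of a convex set is a Minkowski sum, hence convex; it
  contains all displaced points and so their hull.\<close>

lemma hull_perturb_near:
  fixes f g :: "'i \<Rightarrow> 'a::real_inner"
  assumes "\<And>i. i \<in> T \<Longrightarrow> dist (f i) (g i) < r" and "y \<in> convex hull (g ` T)"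
  obtains x where "x \<in> convex hull (f ` T)" "dist x y < r"
proof -
  let ?S = "\<Union>x \<in> convex hull (f ` T). \<Union>v \<in> ball 0 r. {x + v}"
  have "g ` T \<subseteq> ?S"
  proof
    fix z assume "z \<in> g ` T"
    then obtain i where i: "i \<in> T" "z = g i"
      by auto
    then have "f i \<in> convex hull (f ` T)" "g i - f i \<in> ball 0 r"
      using assms(1)[of i] by (auto simp: hull_inc dist_norm norm_minus_commute)
    moreover have "z = f i + (g i - f i)"
      using i by simp
    ultimately show "z \<in> ?S"
      by blast
  qed
  then have "convex hull (g ` T) \<subseteq> ?S"
    by (intro hull_minimal convex_sums) auto
  then obtain x v where "x \<in> convex hull (f ` T)" "v \<in> ball 0 r" "y = x + v"
    using assms(2) by blast
  then show ?thesis
    using that[of x] by (simp add: dist_norm)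
qed

text \<open>If a point near \<open>x\<close> were outside the new hull, a hyperplane would separate
  it from all \<open>g i\<close>. The original points \<open>f i\<close> would then miss an extreme
  point of \<open>cball x r\<close> in the normal direction.\<close>

lemma hull_perturb_interior:
  fixes f g :: "'i \<Rightarrow> 'a::euclidean_space"
  assumes T: "finite T" "T \<noteq> {}" and near: "\<And>i. i \<in> T \<Longrightarrow> dist (f i) (g i) < r"
    and ball: "cball x r \<subseteq> convex hull (f ` T)"
  shows "x \<in> interior (convex hull (g ` T))"
proof -
  \<comment> \<open>The largest displacement; it is strictly below \<open>r\<close> by finiteness,
    which leaves a ball of radius \<open>r - s\<close>.\<close>
  define s where "s = Max ((\<lambda>i. dist (f i) (g i)) ` T)"
  have s: "dist (f i) (g i) \<le> s" if "i \<in> T" for i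
    using that T by (simp add: s_def)
  have "s < r"
    using T near by (simp add: s_def)
  obtain i0 where "i0 \<in> T"
    using T(2) by auto
  have "0 \<le> s"
    using s[OF \<open>i0 \<in> T\<close>] zero_le_dist[of "f i0" "g i0"] by linarith
  have "ball x (r - s) \<subseteq> convex hull (g ` T)"
  proof
    fix y assume y: "y \<in> ball x (r - s)"
    show "y \<in> convex hull (g ` T)"
    proof (rule ccontr)
      assume "y \<notin> convex hull (g ` T)"
      moreover have "closed (convex hull (g ` T))"
        using T by (intro compact_imp_closed compact_convex_hull finite_imp_compact) simp
      ultimately obtain a b where ab: "a \<bullet> y < b" "\<And>z. z \<in> convex hull (g ` T) \<Longrightarrow> b < a \<bullet> z"
        using separating_hyperplane_closed_point[OF convex_convex_hull] by blast
      have gi: "a \<bullet> y < a \<bullet> g i" if "i \<in> T" for i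
        using ab(1) ab(2)[of "g i"] that by (simp add: hull_inc)
      have "a \<noteq> 0"
        using gi[OF \<open>i0 \<in> T\<close>] by auto
      \<comment> \<open>The point of \<open>cball x r\<close> with the least inner product with
        \<open>a\<close>.\<close>
      define w where "w = x - (r / norm a) *\<^sub>R a"
      have aw: "a \<bullet> w = a \<bullet> x - r * norm a"
        using \<open>a \<noteq> 0\<close> by (simp add: w_def inner_diff_right power2_norm_eq_inner[symmetric] power2_eq_square)
      have "w \<in> cball x r"
        using \<open>0 \<le> s\<close> \<open>s < r\<close> \<open>a \<noteq> 0\<close> by (simp add: w_def dist_norm)
      then have "w \<in> convex hull (f ` T)"
        using ball by blast
      moreover have "f ` T \<subseteq> {z. a \<bullet> z > a \<bullet> w}"
      proof
        fix z assume "z \<in> f ` T"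
        then obtain i where i: "i \<in> T" "z = f i"
          by auto
        have "a \<bullet> (g i - f i) \<le> norm a * norm (g i - f i)"
          by (rule norm_cauchy_schwarz)
        also have "\<dots> \<le> norm a * s"
          using s[OF i(1)] by (intro mult_left_mono) (simp_all add: dist_norm norm_minus_commute)
        finally have 1: "a \<bullet> g i \<le> a \<bullet> z + norm a * s"
          by (simp add: i inner_diff_right)
        have "a \<bullet> (x - y) \<le> norm a * norm (x - y)"
          by (rule norm_cauchy_schwarz)
        also have "\<dots> \<le> norm a * (r - s)"
          using y by (intro mult_left_mono) (simp_all add: dist_norm)
        finally have "a \<bullet> x - norm a * (r - s) \<le> a \<bullet> y"
          by (simp add: inner_diff_right)
        then show "z \<in> {z. a \<bullet> z > a \<bullet> w}"
          using 1 gi[OF i(1)] aw by (simp add: algebra_simps)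
      qed
      then have "convex hull (f ` T) \<subseteq> {z. a \<bullet> z > a \<bullet> w}"
        by (intro hull_minimal convex_halfspace_gt)
      ultimately show False
        by auto
    qed
  qed
  moreover have "x \<in> ball x (r - s)"
    using \<open>s < r\<close> by simp
  ultimately show ?thesis
    by (meson interior_maximal open_ball subsetD)
qed

text \<open>The triangle with apex \<open>-c - \<i>\<close> and base \<open>[2c - 1 + 2\<i>, 2c + 1 + 2\<i>]\<close>
  is \<open>{x + y\<i>. -1 \<le> y \<le> 2 \<and> \<bar>x - c y\<bar> \<le> (y + 1)/3}\<close>; only its points at heights 0 and 1 matter.\<close>

definition wedge :: "real \<Rightarrow> complex set" where
  "wedge c = convex hull {Complex (- c) (- 1), Complex (2 * c + 1) 2, Complex (2 * c - 1) 2}"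

lemma wedge_interior:
  assumes "x - c * y < (y + 1) / 3" "c * y - x < (y + 1) / 3" "y < 2"
  shows "Complex x y \<in> interior (wedge c)"
proof -
  \<comment> \<open>\<open>p\<close> is the relative height above the apex and \<open>q\<close> the
    horizontal offset from the axis; the barycentric coordinates are \<open>1 - p\<close>,
    \<open>(p + q) / 2\<close> and \<open>(p - q) / 2\<close>.\<close>
  define p q where "p = (y + 1) / 3" and "q = x - c * y"
  have "q < p" "p < 1"
    using assms(1,3) by (simp_all add: p_def q_def)
  moreover have "- q < p"
    using assms(2) unfolding p_def q_def by linarith
  ultimately have pq: "0 < 1 - p" "0 < (p + q) / 2" "0 < (p - q) / 2"
    by simp_all
  have comb: "(1 - p) *\<^sub>R Complex (- c) (- 1) + ((p + q) / 2) *\<^sub>R Complex (2 * c + 1) 2 +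
      ((p - q) / 2) *\<^sub>R Complex (2 * c - 1) 2 = Complex x y"
    by (simp add: complex_eq_iff p_def q_def field_simps)
  have "\<not> collinear {Complex (- c) (- 1), Complex (2 * c + 1) 2, Complex (2 * c - 1) 2}"
    by (simp add: collinear_iff_cross cross_def)
  then have int: "interior (wedge c) = {v. \<exists>x y z. 0 < x \<and> 0 < y \<and> 0 < z \<and> x + y + z = 1 \<and>
      x *\<^sub>R Complex (- c) (- 1) + y *\<^sub>R Complex (2 * c + 1) 2 + z *\<^sub>R Complex (2 * c - 1) 2 = v}"
    unfolding wedge_def by (rule interior_convex_hull_3_minimal) simp
  show ?thesis
    unfolding int mem_Collect_eq
  proof (intro exI conjI)
    show "(1 - p) + (p + q) / 2 + (p - q) / 2 = 1"
      by (simp add: field_simps)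
  qed (fact pq comb)+
qed

lemma wedge_bound:
  assumes "z \<in> wedge c"
  shows "\<bar>Re z - c * Im z\<bar> \<le> (Im z + 1) / 3"
proof -
  have "convex {z. \<bar>Re z - c * Im z\<bar> \<le> (Im z + 1) / 3}"
  proof -
    have eq: "{z. \<bar>Re z - c * Im z\<bar> \<le> (Im z + 1) / 3} =
        {z. Complex 1 (- c - 1/3) \<bullet> z \<le> 1 / 3} \<inter> {z. Complex (- 1) (c - 1/3) \<bullet> z \<le> 1 / 3}"
    proof (intro set_eqI)
      fix z
      have "Complex 1 (- c - 1/3) \<bullet> z = Re z - c * Im z - Im z / 3"
        "Complex (- 1) (c - 1/3) \<bullet> z = c * Im z - Re z - Im z / 3"
        by (simp_all add: inner_complex_def algebra_simps)
      then show "z \<in> {z. \<bar>Re z - c * Im z\<bar> \<le> (Im z + 1) / 3} \<longleftrightarrow>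
          z \<in> {z. Complex 1 (- c - 1/3) \<bullet> z \<le> 1 / 3} \<inter> {z. Complex (- 1) (c - 1/3) \<bullet> z \<le> 1 / 3}"
        unfolding mem_Collect_eq Int_iff abs_le_iff by argo
    qed
    show ?thesis
      unfolding eq by (intro convex_Int convex_halfspace_le)
  qed
  then have "wedge c \<subseteq> {z. \<bar>Re z - c * Im z\<bar> \<le> (Im z + 1) / 3}"
    unfolding wedge_def by (intro hull_minimal) auto
  then show ?thesis
    using assms by auto
qed

section \<open>The configuration before perturbation\<close>

definition tri :: "nat \<Rightarrow> nat set" where
  "tri t = {3 * t, 3 * t + 1, 3 * t + 2}"

text \<open>Triangle \<open>0\<close> is degenerate here: the segment from \<open>\<i>\<close> to \<open>n - 1 + \<i>\<close>, whose unit piece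
  between \<open>t - 1 + \<i>\<close> and \<open>t + \<i>\<close> is covered by triangle \<open>t\<close>. Perturbation turns it into a thin triangle.\<close>

definition corner :: "nat \<Rightarrow> nat \<Rightarrow> complex" where
  "corner n i = (let t = i div 3; c = real t - 1 / 2 in
     if t = 0 then Complex (if i = 2 then real (n - 1) else 0) 1
     else if i mod 3 = 0 then Complex (- c) (- 1)
     else if i mod 3 = 1 then Complex (2 * c + 1) 2 else Complex (2 * c - 1) 2)"

lemma corner_tri_0: "convex hull (corner n ` tri 0) = closed_segment (Complex 0 1) (Complex (real (n - 1)) 1)"
  by (simp add: tri_def corner_def segment_convex_hull)

lemma corner_tri_pos:
  assumes "0 < t"
  shows "convex hull (corner n ` tri t) = wedge (real t - 1 / 2)"
proof -
  have "(3 * t + 1) div 3 = t" "(3 * t + 1) mod 3 = 1" "(3 * t + 2) div 3 = t" "(3 * t + 2) mod 3 = 2"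
    by presburger+
  then show ?thesis
    using assms by (simp add: tri_def corner_def wedge_def Let_def insert_commute)
qed

lemma mem_tri_0: "z \<in> convex hull (corner n ` tri 0) \<longleftrightarrow> Im z = 1 \<and> 0 \<le> Re z \<and> Re z \<le> real (n - 1)"
proof
  assume "z \<in> convex hull (corner n ` tri 0)"
  then obtain u where u: "0 \<le> u" "u \<le> 1" "z = (1 - u) *\<^sub>R Complex 0 1 + u *\<^sub>R Complex (real (n - 1)) 1"
    unfolding corner_tri_0 by (auto simp: in_segment)
  then have "Re z = u * real (n - 1)" "Im z = 1"
    by simp_all
  then show "Im z = 1 \<and> 0 \<le> Re z \<and> Re z \<le> real (n - 1)"
    using u mult_right_mono[of u 1 "real (n - 1)"] by simp
next
  assume z: "Im z = 1 \<and> 0 \<le> Re z \<and> Re z \<le> real (n - 1)"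
  show "z \<in> convex hull (corner n ` tri 0)"
    unfolding corner_tri_0 in_segment
  proof (intro exI conjI)
    let ?u = "Re z / real (n - 1)"
    show "0 \<le> ?u" "?u \<le> 1"
      using z by (auto simp: divide_le_eq_1)
    show "z = (1 - ?u) *\<^sub>R Complex 0 1 + ?u *\<^sub>R Complex (real (n - 1)) 1"
      using z by (cases "n - 1 = 0") (auto simp: complex_eq_iff simp del: of_nat_diff)
  qed
qed

text \<open>At height 1 wedge \<open>t\<close> is centred at \<open>t - 1 / 2\<close> with
  half-width 2/3, more than the 1/2 needed for its closed unit piece.\<close>

lemma tri_0_covered:
  assumes "z \<in> convex hull (corner n ` tri 0)" "2 \<le> n"
  shows "\<exists>t \<in> {1..<n}. z \<in> interior (convex hull (corner n ` tri t))"
proof -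
  have z: "Im z = 1" "0 \<le> Re z" "Re z \<le> real (n - 1)"
    using assms(1) mem_tri_0 by auto
  obtain t where t: "t \<in> {1..<n}" "real t - 1 \<le> Re z" "Re z \<le> real t"
  \<comment> \<open>At the right end of the segment the rounded index would be \<open>n\<close>, so
    it is assigned to the last wedge.\<close>
  proof (cases "Re z = real (n - 1)")
    case True
    then show ?thesis
      using assms(2) by (intro that[of "n - 1"]) auto
  next
    case False
    define t where "t = nat \<lfloor>Re z\<rfloor> + 1"
    have "real t = of_int \<lfloor>Re z\<rfloor> + 1"
      using z(2) by (simp add: t_def)
    then have "real t - 1 \<le> Re z" "Re z \<le> real t"
      by linarith+
    moreover from this have "real t - 1 < real (n - 1)"
      using z(3) False by linarith
    then have "t \<in> {1..<n}"
      by (auto simp: t_def)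
    ultimately show ?thesis
      using that by blast
  qed
  have "Complex (Re z) 1 \<in> interior (wedge (real t - 1 / 2))"
    using t(2,3) by (intro wedge_interior) simp_all
  moreover have "Complex (Re z) 1 = z"
    using z(1) by (simp add: complex_eq_iff)
  ultimately show ?thesis
    using t(1) corner_tri_pos[of t n] by (intro bexI[of _ t]) auto
qed

text \<open>The midpoint of the \<open>t\<close>-th unit piece of the segment, which lies in the \<open>t\<close>-th wedge only.\<close>

definition mid :: "nat \<Rightarrow> complex" where "mid t = Complex (real t - 1 / 2) 1"

lemma mid_mem: "t \<in> {1..<n} \<Longrightarrow> mid t \<in> convex hull (corner n ` tri 0)"
  unfolding mem_tri_0 by (auto simp: mid_def)

text \<open>At height 1 the axes of distinct wedges are at least 1 apart, more than the half-width
  2/3.\<close>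

lemma mid_notin:
  assumes "0 < t" "t \<noteq> j"
  shows "mid j \<notin> convex hull (corner n ` tri t)"
proof
  assume "mid j \<in> convex hull (corner n ` tri t)"
  then have "\<bar>real j - real t\<bar> \<le> 2 / 3"
    using wedge_bound[of "mid j" "real t - 1 / 2"] assms(1) by (simp add: corner_tri_pos mid_def)
  moreover have "t + 1 \<le> j \<or> j + 1 \<le> t"
    using assms(2) by linarith
  then have "1 \<le> \<bar>real j - real t\<bar>"
    by auto
  ultimately show False
    by simp
qed

text \<open>The filter form lets finitely many smallness conditions on one radius be
  combined.\<close>

lemma eventually_small_radius:
  assumes "open S" "x \<in> S"
  shows "\<forall>\<^sub>F r in at_right 0. cball x (3 * r) \<subseteq> S"
proof -
  obtain e where "e > 0" "ball x e \<subseteq> S"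
    using assms by (meson open_contains_ball)
  then show ?thesis
    unfolding eventually_at_right_field
    by (intro exI[of _ "e / 3"]) (auto simp: subset_iff)
qed

text \<open>The margins are tailored to displacements below \<open>r\<close>: one \<open>r\<close>
  for a hull containing 0, two for the cover, where the point moves as well, and three for the gaps,
  where an interior approximation is added.\<close>

lemma corner_radius:
  assumes "2 \<le> n"
  obtains r where "0 < r" "r < 1"
    and "\<And>x. x \<in> convex hull (corner n ` tri 0) \<Longrightarrow>
      \<exists>t \<in> {1..<n}. cball x (2 * r) \<subseteq> convex hull (corner n ` tri t)"
    and "\<And>t. t \<in> {1..<n} \<Longrightarrow> cball 0 r \<subseteq> convex hull (corner n ` tri t)"
    and "\<And>t j. t \<in> {1..<n} \<Longrightarrow> j \<in> {1..<n} \<Longrightarrow> t \<noteq> j \<Longrightarrow>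
      cball (mid j) (3 * r) \<inter> convex hull (corner n ` tri t) = {}"
proof -
  let ?H = "\<lambda>t. convex hull (corner n ` tri t)"
  have "compact (?H t)" for t
    by (intro compact_convex_hull finite_imp_compact) (simp add: tri_def)
  then have cl: "compact (?H 0)" "\<And>t. closed (?H t)"
    by (auto intro: compact_imp_closed)
  \<comment> \<open>A Lebesgue number of the open cover of the compact segment.\<close>
  obtain e where e: "0 < e" "\<And>x. x \<in> ?H 0 \<Longrightarrow> \<exists>G \<in> (\<lambda>t. interior (?H t)) ` {1..<n}. ball x e \<subseteq> G"
    by (rule Heine_Borel_lemma[OF cl(1), of "(\<lambda>t. interior (?H t)) ` {1..<n}"])
       (use tri_0_covered assms in auto)
  have "\<forall>\<^sub>F r in at_right 0. 0 < r \<and> r < min 1 (e / 2)"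
    using e(1) unfolding eventually_at_right_field by (intro exI[of _ "min 1 (e / 2)"]) auto
  moreover have "\<forall>\<^sub>F r in at_right 0. \<forall>t \<in> {1..<n}. cball 0 (3 * r) \<subseteq> interior (?H t)"
  proof (intro eventually_ball_finite ballI)
    fix t assume "t \<in> {1..<n}"
    moreover have "Complex 0 0 \<in> interior (wedge (real t - 1 / 2))"
      by (rule wedge_interior) auto
    ultimately have "0 \<in> interior (?H t)"
      using corner_tri_pos[of t n] by (simp add: zero_complex.code[symmetric])
    then show "\<forall>\<^sub>F r in at_right 0. cball 0 (3 * r) \<subseteq> interior (?H t)"
      by (intro eventually_small_radius) auto
  qed auto
  moreover have "\<forall>\<^sub>F r in at_right 0. \<forall>t \<in> {1..<n}. \<forall>j \<in> {1..<n}. t \<noteq> j \<longrightarrow> cball (mid j) (3 * r) \<subseteq> - ?H t"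
  proof (intro eventually_ball_finite ballI)
    fix t j assume "t \<in> {1..<n}" "j \<in> {1..<n}"
    then show "\<forall>\<^sub>F r in at_right 0. t \<noteq> j \<longrightarrow> cball (mid j) (3 * r) \<subseteq> - ?H t"
      using eventually_small_radius[of "- ?H t" "mid j"] cl(2)[of t] mid_notin[of t j n] by (cases "t = j") auto
  qed auto
  ultimately have "\<forall>\<^sub>F r in at_right 0. (0 < r \<and> r < min 1 (e / 2)) \<and>
      (\<forall>t \<in> {1..<n}. cball 0 (3 * r) \<subseteq> interior (?H t)) \<and>
      (\<forall>t \<in> {1..<n}. \<forall>j \<in> {1..<n}. t \<noteq> j \<longrightarrow> cball (mid j) (3 * r) \<subseteq> - ?H t)"
    by (simp only: eventually_conj_iff)
  from eventually_happens'[OF trivial_limit_at_right_real this]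
  obtain r where R: "(0 < r \<and> r < min 1 (e / 2)) \<and>
      (\<forall>t \<in> {1..<n}. cball 0 (3 * r) \<subseteq> interior (?H t)) \<and>
      (\<forall>t \<in> {1..<n}. \<forall>j \<in> {1..<n}. t \<noteq> j \<longrightarrow> cball (mid j) (3 * r) \<subseteq> - ?H t)" ..
  then have r: "0 < r" "r < 1" "r < e / 2"
    by simp_all
  have r0: "\<forall>t \<in> {1..<n}. cball 0 (3 * r) \<subseteq> interior (?H t)"
    and rm: "\<forall>t \<in> {1..<n}. \<forall>j \<in> {1..<n}. t \<noteq> j \<longrightarrow> cball (mid j) (3 * r) \<subseteq> - ?H t"
    using R by blast+
  show ?thesis
  proof (rule that[OF r(1,2)])
    fix x assume "x \<in> ?H 0"
    then obtain t where "t \<in> {1..<n}" "ball x e \<subseteq> interior (?H t)"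
      using e(2) by blast
    moreover have "cball x (2 * r) \<subseteq> ball x e"
      using r(3) by auto
    ultimately show "\<exists>t \<in> {1..<n}. cball x (2 * r) \<subseteq> ?H t"
      using interior_subset by blast
  next
    fix t assume "t \<in> {1..<n}"
    moreover have "cball (0::complex) r \<subseteq> cball 0 (3 * r)"
      using r(1) by auto
    ultimately show "cball 0 r \<subseteq> ?H t"
      using r0 interior_subset by blast
  next
    fix t j assume "t \<in> {1..<n}" "j \<in> {1..<n}" "t \<noteq> j"
    then show "cball (mid j) (3 * r) \<inter> ?H t = {}"
      using rm by blast
  qed
qed

section \<open>The perturbed configuration\<close>

lemma generic_triangles:
  assumes "2 \<le> n"
  obtains f where "general_position (3 * n) f"
    and "0 \<notin> convex hull (f ` tri 0)"
    and "\<And>t. t \<in> {1..<n} \<Longrightarrow> 0 \<in> interior (convex hull (f ` tri t))"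
    and "convex hull (f ` tri 0) \<subseteq> (\<Union>t \<in> {1..<n}. interior (convex hull (f ` tri t)))"
    and "\<And>j. j \<in> {1..<n} \<Longrightarrow>
      \<exists>q \<in> interior (convex hull (f ` tri 0)). \<forall>t \<in> {1..<n} - {j}. q \<notin> convex hull (f ` tri t)"
proof -
  obtain r where r: "0 < r" "r < 1"
    and cover: "\<And>x. x \<in> convex hull (corner n ` tri 0) \<Longrightarrow>
      \<exists>t \<in> {1..<n}. cball x (2 * r) \<subseteq> convex hull (corner n ` tri t)"
    and zero: "\<And>t. t \<in> {1..<n} \<Longrightarrow> cball 0 r \<subseteq> convex hull (corner n ` tri t)"
    and mid: "\<And>t j. t \<in> {1..<n} \<Longrightarrow> j \<in> {1..<n} \<Longrightarrow> t \<noteq> j \<Longrightarrow>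
      cball (mid j) (3 * r) \<inter> convex hull (corner n ` tri t) = {}"
    using corner_radius[OF assms] by metis
  have "\<exists>f. (\<forall>i<3 * n. f i \<in> ball (corner n i) r) \<and> generic (3 * n) f"
    using r(1) by (intro generic_exists) auto
  then obtain f where f: "\<And>i. i < 3 * n \<Longrightarrow> dist (corner n i) (f i) < r" and gen: "generic (3 * n) f"
    by auto
  have gp: "general_position (3 * n) f"
    using general_position_generic[OF gen] assms by simp
  interpret general_position "3 * n" f
    by (rule gp)
  have near: "dist (corner n i) (f i) < r" if "t < n" "i \<in> tri t" for t i
    using f[of i] that by (auto simp: tri_def)
  have from_f: "\<exists>x \<in> convex hull (corner n ` tri t). dist x y < r"
    if "t < n" "y \<in> convex hull (f ` tri t)" for t y
    using hull_perturb_near[of "tri t" "corner n" f r y] near that by metis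
  have to_f: "\<exists>y \<in> convex hull (f ` tri t). dist y x < r"
    if "t < n" "x \<in> convex hull (corner n ` tri t)" for t x
    using hull_perturb_near[of "tri t" f "corner n" r x] near that by (metis dist_commute)
  have interior_f: "y \<in> interior (convex hull (f ` tri t))"
    if "t < n" "cball y r \<subseteq> convex hull (corner n ` tri t)" for t y
    using near[OF that(1)] that(2)
    by (intro hull_perturb_interior[of "tri t" "corner n" f r]) (auto simp: tri_def)
  have tri3: "tri 0 \<in> nsets {..<3 * n} 3"
    using assms by (simp add: tri_def nsets_def)
  have "0 < n"
    using assms by simp
  show ?thesis
  proof (rule that[OF gp])
    show "0 \<notin> convex hull (f ` tri 0)"
    proof
      assume "0 \<in> convex hull (f ` tri 0)"
      then obtain x where x: "x \<in> convex hull (corner n ` tri 0)" "dist x 0 < r"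
        using from_f[OF \<open>0 < n\<close>] by blast
      then have "Im x = 1"
        by (simp add: mem_tri_0)
      then show False
        using abs_Im_le_cmod[of x] x(2) r(2) by simp
    qed
  next
    fix t assume t: "t \<in> {1..<n}"
    then have "t < n"
      by simp
    show "0 \<in> interior (convex hull (f ` tri t))"
      by (rule interior_f[OF \<open>t < n\<close> zero[OF t]])
  next
    show "convex hull (f ` tri 0) \<subseteq> (\<Union>t \<in> {1..<n}. interior (convex hull (f ` tri t)))"
    proof
      fix y assume "y \<in> convex hull (f ` tri 0)"
      then obtain x where x: "x \<in> convex hull (corner n ` tri 0)" "dist x y < r"
        using from_f[OF \<open>0 < n\<close>] by blast
      obtain t where t: "t \<in> {1..<n}" "cball x (2 * r) \<subseteq> convex hull (corner n ` tri t)"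
        using cover[OF x(1)] by blast
      have "cball y r \<subseteq> cball x (2 * r)"
      proof
        fix z assume "z \<in> cball y r"
        then show "z \<in> cball x (2 * r)"
          using dist_triangle[of x z y] x(2) by simp
      qed
      then have "cball y r \<subseteq> convex hull (corner n ` tri t)"
        using t(2) by blast
      moreover have "t < n"
        using t(1) by simp
      ultimately have "y \<in> interior (convex hull (f ` tri t))"
        by (intro interior_f)
      then show "y \<in> (\<Union>t \<in> {1..<n}. interior (convex hull (f ` tri t)))"
        using t(1) by blast
    qed
  next
    fix j assume j: "j \<in> {1..<n}"
    \<comment> \<open>A point of the perturbed thin triangle near \<open>mid j\<close>, then moved
      by less than \<open>r\<close> to an interior point \<open>q\<close>. A wedge point within
      \<open>r\<close> of \<open>q\<close> would be within \<open>3 * r\<close> of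
      \<open>mid j\<close>.\<close>
    obtain y where y: "y \<in> convex hull (f ` tri 0)" "dist y (mid j) < r"
      using to_f[OF \<open>0 < n\<close> mid_mem[OF j]] by blast
    have "interior (convex hull (f ` tri 0)) \<noteq> {}"
      using convex_body.interior[OF triangle_body(1)[OF tri3]] .
    then have "y \<in> closure (interior (convex hull (f ` tri 0)))"
      using y(1) convex_closure_interior closure_subset by (metis convex_convex_hull subsetD)
    then obtain q where q: "q \<in> interior (convex hull (f ` tri 0))" "dist q y < r"
      using r(1) by (meson closure_approachable)
    have "q \<notin> convex hull (f ` tri t)" if t: "t \<in> {1..<n} - {j}" for t
    proof
      assume "q \<in> convex hull (f ` tri t)"
      moreover have "t < n"
        using t by simp
      ultimately obtain x where x: "x \<in> convex hull (corner n ` tri t)" "dist x q < r"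
        using from_f by blast
      have "dist (mid j) x \<le> 3 * r"
        using dist_triangle[of "mid j" x y] dist_triangle[of y x q] y(2) q(2) x(2)
        by (simp add: dist_commute)
      then show False
        using mid[of t j] t j x(1) by auto
    qed
    with q(1) show "\<exists>q \<in> interior (convex hull (f ` tri 0)). \<forall>t \<in> {1..<n} - {j}. q \<notin> convex hull (f ` tri t)"
      by blast
  qed
qed

section \<open>Helly numbers and the counterexample\<close>

text \<open>Fewer than \<open>n\<close> sets come from at most \<open>n - 1\<close> indices.
  Enlarging the index set to size \<open>n - 1\<close> only shrinks the intersection, which is still
  nonempty.\<close>

lemma helly_number_ge:
  assumes "finite F" "card F = n" "(\<Inter>T\<in>F. B T) = {}"
    and sub: "\<And>G. G \<subseteq> F \<Longrightarrow> card G = n - 1 \<Longrightarrow> (\<Inter>T\<in>G. B T) \<noteq> {}"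
  shows "helly_number (B ` F) \<ge> n"
proof (rule ccontr)
  let ?P = "\<lambda>k. \<exists>G. G \<subseteq> B ` F \<and> finite G \<and> card G = k \<and> \<Inter>G = {}"
  assume "\<not> helly_number (B ` F) \<ge> n"
  then have less: "helly_number (B ` F) < n"
    by simp
  \<comment> \<open>The whole family witnesses that the \<open>LEAST\<close> in
    \<open>helly_number\<close> is attained.\<close>
  have "?P (card (B ` F))"
    using assms(1,3) by (intro exI[of _ "B ` F"]) auto
  then have "?P (helly_number (B ` F))"
    unfolding helly_number_def by (rule LeastI)
  then obtain G where G: "G \<subseteq> B ` F" "card G < n" "\<Inter>G = {}"
    using less by auto
  \<comment> \<open>One index per member, as \<open>B\<close> may identify several indices.\<close>
  obtain G' where G': "G' \<subseteq> F" "inj_on B G'" "G = B ` G'"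
    using G(1) by (meson subset_image_inj)
  then have "card G' \<le> n - 1"
    using G(2) by (simp add: card_image)
  then obtain G'' where "G' \<subseteq> G''" "G'' \<subseteq> F" "card G'' = n - 1"
    using exists_subset_between[of G' "n - 1" F] G'(1) assms(1,2) by auto
  then show False
    using sub[of G''] G(3) G'(3) by blast
qed

lemma helly_counterexample:
  assumes "3 \<le> n"
  shows "\<exists>D F. topological_drawing (3 * n) D \<and> cell_convex (3 * n) D \<and>
    F \<subseteq> nsets {..<3 * n} 3 \<and> finite F \<and> card F = n \<and>
    (\<forall>G \<subseteq> F. card G = n - 1 \<longrightarrow> (\<Inter>T\<in>G. interior (bounded_side D T)) \<noteq> {}) \<and>
    (\<Inter>T\<in>F. bounded_side D T) = {}"
proof -
  have "2 \<le> n"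
    using assms by simp
  then obtain f where gp: "general_position (3 * n) f"
    and zero_out: "0 \<notin> convex hull (f ` tri 0)"
    and zero_in: "\<And>t. t \<in> {1..<n} \<Longrightarrow> 0 \<in> interior (convex hull (f ` tri t))"
    and cover: "convex hull (f ` tri 0) \<subseteq> (\<Union>t \<in> {1..<n}. interior (convex hull (f ` tri t)))"
    and gap: "\<And>j. j \<in> {1..<n} \<Longrightarrow>
      \<exists>q \<in> interior (convex hull (f ` tri 0)). \<forall>t \<in> {1..<n} - {j}. q \<notin> convex hull (f ` tri t)"
    by (rule generic_triangles) metis
  interpret general_position "3 * n" f
    by (rule gp)
  define F where "F = tri ` {..<n}"
  have tri: "tri t \<in> nsets {..<3 * n} 3" if "t < n" for t
    using that by (auto simp: tri_def nsets_def)
  have zero_in': "0 \<in> convex hull (f ` tri t)" if "t \<in> {1..<n}" for t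
    using zero_in[OF that] interior_subset by blast
  have inj: "inj_on tri {..<n}"
  proof (rule inj_onI)
    fix s t assume "tri s = tri t"
    moreover have "Min (tri u) = 3 * u" for u
      by (simp add: tri_def)
    ultimately show "s = t"
      by (metis mult_cancel1 zero_neq_numeral)
  qed
  then have card: "card F = n" and fin: "finite F"
    by (simp_all add: F_def card_image)
  have witness: "\<exists>w. \<forall>t \<in> {..<n} - {j}. w \<in> interior (bounded_side D (tri t))" if "j < n" for j
  proof (cases "j = 0")
    \<comment> \<open>Without triangle 0, the point 0 serves: it is interior to the bounded side of
      every inverted wedge.\<close>
    case True
    then show ?thesis
      using bounded_side_zero_in(2)[OF tri zero_in', of _ 0] by (intro exI[of _ 0]) auto
  next
    case False
    then have "j \<in> {1..<n}"
      using that by simp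
    then obtain q where q: "q \<in> interior (convex hull (f ` tri 0))" "\<And>t. t \<in> {1..<n} - {j} \<Longrightarrow> q \<notin> convex hull (f ` tri t)"
      using gap by blast
    \<comment> \<open>Without wedge \<open>j\<close>, the inverse of a point of triangle 0 missed by
      the other wedges serves.\<close>
    have "inverse q \<in> interior (bounded_side D (tri t))" if t: "t \<in> {..<n} - {j}" for t
    proof (cases "t = 0")
      case True
      then show ?thesis
        using bounded_side_zero_notin(2)[OF tri zero_out] q(1) assms by auto
    next
      case False
      then have "t \<in> {1..<n} - {j}"
        using t by auto
      then show ?thesis
        using bounded_side_zero_in(2)[OF tri zero_in', of t "inverse q"] q(2) by simp
    qed
    then show ?thesis
      by blast
  qed
  have "(\<Inter>T\<in>G. interior (bounded_side D T)) \<noteq> {}" if G: "G \<subseteq> F" "card G = n - 1" for G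
  proof -
    have "card (F - G) = 1"
      using G card fin assms by (simp add: card_Diff_subset finite_subset)
    then obtain T where T: "F - G = {T}"
      by (meson card_1_singletonE)
    then have "T \<in> F"
      by blast
    with T obtain j where j: "j < n" "F - G = {tri j}"
      unfolding F_def by blast
    then obtain w where w: "\<And>t. t \<in> {..<n} - {j} \<Longrightarrow> w \<in> interior (bounded_side D (tri t))"
      using witness[OF j(1)] by blast
    have "w \<in> interior (bounded_side D T)" if TG: "T \<in> G" for T
    proof -
      obtain t where "t < n" "T = tri t"
        using G(1) TG unfolding F_def by blast
      moreover have "T \<noteq> tri j"
        using j(2) TG by blast
      ultimately show ?thesis
        using w[of t] by (metis Diff_iff lessThan_iff singletonD)
    qed
    then show ?thesis
      by blast
  qed
  moreover have "(\<Inter>T\<in>F. bounded_side D T) = {}"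
  proof (rule ccontr)
    assume "(\<Inter>T\<in>F. bounded_side D T) \<noteq> {}"
    then obtain w where w: "\<And>t. t < n \<Longrightarrow> w \<in> bounded_side D (tri t)"
      by (auto simp: F_def)
    \<comment> \<open>A common point pulls back into triangle 0, hence into the interior of some
      wedge, which the bounded side of that inverted wedge excludes.\<close>
    have w0: "inverse w \<in> convex hull (f ` tri 0)"
      using w[of 0] assms bounded_side_zero_notin(1)[OF tri zero_out] by (simp add: mem_inverse_image)
    then have "w \<noteq> 0"
      using zero_out by auto
    obtain t where t: "t \<in> {1..<n}" "inverse w \<in> interior (convex hull (f ` tri t))"
      using cover w0 by blast
    then show False
      using bounded_side_zero_in(1)[OF tri zero_in', of t w] w[of t] \<open>w \<noteq> 0\<close> by simp
  qed
  moreover have "F \<subseteq> nsets {..<3 * n} 3"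
    using tri by (auto simp: F_def)
  ultimately show ?thesis
    using topological_drawing_D cell_convex_D card fin by blast
qed

theorem proposition3:
  "(\<exists>m D F. topological_drawing m D \<and> cell_convex m D \<and>
      F \<subseteq> nsets {..<m} 3 \<and> finite F \<and> card F \<ge> 3 \<and>
      (\<forall>G \<subseteq> F. card G = 3 \<longrightarrow> (\<Inter>T\<in>G. bounded_side D T) \<noteq> {}) \<and>
      (\<Inter>T\<in>F. bounded_side D T) = {}) \<and>
   (\<forall>n::nat. n \<ge> 3 \<longrightarrow>
     (\<exists>D F. topological_drawing (3 * n) D \<and> cell_convex (3 * n) D \<and>
        F \<subseteq> nsets {..<3 * n} 3 \<and> finite F \<and> card F = n \<and>
        (\<forall>G \<subseteq> F. card G = n - 1 \<longrightarrow> (\<Inter>T\<in>G. interior (bounded_side D T)) \<noteq> {}) \<and>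
        (\<Inter>T\<in>F. bounded_side D T) = {} \<and>
        helly_number (bounded_side D ` F) \<ge> n))"
proof (intro conjI allI impI)
  have sub: "(\<Inter>T\<in>G. interior (bounded_side D T)) \<subseteq> (\<Inter>T\<in>G. bounded_side D T)" for D G
    using interior_subset by (intro INF_mono) auto
  \<comment> \<open>With \<open>n = 4\<close> the subfamilies of size \<open>n - 1\<close> are
    exactly the triples of Helly's theorem.\<close>
  obtain D F where D: "topological_drawing (3 * 4) D" "cell_convex (3 * 4) D"
    "F \<subseteq> nsets {..<3 * 4} 3" "finite F" "card F = 4" "(\<Inter>T\<in>F. bounded_side D T) = {}"
    and G: "\<And>G. G \<subseteq> F \<Longrightarrow> card G = 3 \<Longrightarrow> (\<Inter>T\<in>G. interior (bounded_side D T)) \<noteq> {}"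
    using helly_counterexample[of 4] by auto
  have "(\<Inter>T\<in>G. bounded_side D T) \<noteq> {}" if "G \<subseteq> F" "card G = 3" for G
    using G[OF that] sub by blast
  moreover have "card F \<ge> 3"
    using D(5) by simp
  ultimately show "\<exists>m D F. topological_drawing m D \<and> cell_convex m D \<and>
      F \<subseteq> nsets {..<m} 3 \<and> finite F \<and> card F \<ge> 3 \<and>
      (\<forall>G \<subseteq> F. card G = 3 \<longrightarrow> (\<Inter>T\<in>G. bounded_side D T) \<noteq> {}) \<and>
      (\<Inter>T\<in>F. bounded_side D T) = {}"
    using D by blast
  fix n :: nat assume "n \<ge> 3"
  then obtain D F where D: "topological_drawing (3 * n) D" "cell_convex (3 * n) D"
    "F \<subseteq> nsets {..<3 * n} 3" "finite F" "card F = n" "(\<Inter>T\<in>F. bounded_side D T) = {}"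
    and G: "\<And>G. G \<subseteq> F \<Longrightarrow> card G = n - 1 \<Longrightarrow> (\<Inter>T\<in>G. interior (bounded_side D T)) \<noteq> {}"
    using helly_counterexample[of n] by blast
  have "(\<Inter>T\<in>G. bounded_side D T) \<noteq> {}" if "G \<subseteq> F" "card G = n - 1" for G
    using G[OF that] sub by blast
  then have "helly_number (bounded_side D ` F) \<ge> n"
    using D by (intro helly_number_ge) auto
  then show "\<exists>D F. topological_drawing (3 * n) D \<and> cell_convex (3 * n) D \<and>
        F \<subseteq> nsets {..<3 * n} 3 \<and> finite F \<and> card F = n \<and>
        (\<forall>G \<subseteq> F. card G = n - 1 \<longrightarrow> (\<Inter>T\<in>G. interior (bounded_side D T)) \<noteq> {}) \<and>
        (\<Inter>T\<in>F. bounded_side D T) = {} \<and>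
        helly_number (bounded_side D ` F) \<ge> n"
    using D G by blast
qed

end
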